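(* As $n\to\infty$, $\mu\to0$ with $n\mu\to\theta\in[0,\infty)$, and $|\mathcal{S}|\to\infty$, $$\frac{1}{|\mathcal{S}|}\sum_{i\in\mathcal{S}}\delta_{B_i^{n,\mu}}\longrightarrow \Lambda$$ in probability, where $\Lambda$ is the Luria–Delbrück distribution with parameter $2\theta$, and convergence is in the space of probability measures on $\mathbb{N}_0$ with the topology of weak convergence.
   Context: Basic model. Let $\mathcal{N}=\{A,C,G,T\}$, let $\mathcal{S}$ be a finite nonempty set of sites, and let $\mathcal{G}=\mathcal{N}^{\mathcal{S}}$. The model starts with one cell with genome $u=(u_i)_{i\in\mathcal{S}}$. Each cell lives for an independent Exp(1) time and is then replaced by two daughter cells. When a cell with genome $v$ divides, the daughters' genomes $V^{(1)},V^{(2)}$ are such that, conditionally on $v$, the $V_i^{(r)}$ are independent over $i\in\mathcal{S}$, $r\in\{1,2\}$, with $\mathbb{P}[V_i^{(r)}=\psi\mid v]=\mu/3$ if $\psi\ne v_i$ and $1-\mu$ if $\psi=v_i$; mutations at different divisions are independent. $\sigma_n$ is the first time there are $n$ alive cells, and $B_i^{n,\mu}$ is the number of cells alive at $\sigma_n$ whose nucleotide at site $i$ differs from $u_i$. The limit is taken along arbitrary sequences of $(n,\mu,\mathcal{S})$ with the stated asymptotics. Luria–Delbrück distribution with parameter $c\ge0$: the law of $\sum_{k=1}^K Y_k$ with $(Y_k)$ i.i.d., $\mathbb{P}[Y_1=j]=\frac1{j(j+1)}$, $j\in\mathbb{N}$, and $K\sim$ Poisson$(c)$ independent. *)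

theory Defs
  imports "HOL-Probability.Probability"
begin

datatype nucleotide = NA | NC | NG | NT

definition nuc_of_nat :: "nat \<Rightarrow> nucleotide" where
  "nuc_of_nat k = [NA, NC, NG, NT] ! (k mod 4)"

fun nat_of_nuc :: "nucleotide \<Rightarrow> nat" where
  "nat_of_nuc NA = 0" | "nat_of_nuc NC = 1" | "nat_of_nuc NG = 2" | "nat_of_nuc NT = 3"

text \<open>Cyclic shift of a nucleotide by k positions; shifts 1,2,3 give the three other nucleotides.\<close>
definition mutate :: "nucleotide \<Rightarrow> nat \<Rightarrow> nucleotide" where
  "mutate v k = nuc_of_nat (nat_of_nuc v + k)"

text \<open>Law of the shift at one site of one daughter: 0 (no mutation) with probability 1 - mu,
  otherwise uniform on 1,2,3, i.e. each of the three other nucleotides with probability mu/3.\<close>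
definition mut_pmf :: "real \<Rightarrow> nat pmf" where
  "mut_pmf mu = bind_pmf (bernoulli_pmf mu)
      (\<lambda>b. if b then pmf_of_set {1, 2, 3} else return_pmf 0)"

text \<open>Cells are labelled by binary words (Ulam-Harris): the root is [], the daughters of w
  are w @ [False] and w @ [True].  Each cell has an independent Exp(1) lifetime, and each
  (cell, site) pair has an independent mutation shift (used for the daughter cell w when
  it is created from its mother).\<close>

type_synonym cell = "bool list"
type_synonym omega = "(cell \<Rightarrow> real) \<times> (cell \<times> nat \<Rightarrow> nat)"

definition lifetime_space :: "(cell \<Rightarrow> real) measure" where
  "lifetime_space = PiM UNIV (\<lambda>_. density lborel (exponential_density 1))"

definition mutation_space :: "real \<Rightarrow> (cell \<times> nat \<Rightarrow> nat) measure" where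
  "mutation_space mu = PiM UNIV (\<lambda>_. measure_pmf (mut_pmf mu))"

definition cell_space :: "real \<Rightarrow> omega measure" where
  "cell_space mu = lifetime_space \<Otimes>\<^sub>M mutation_space mu"

definition birth :: "(cell \<Rightarrow> real) \<Rightarrow> cell \<Rightarrow> real" where
  "birth L w = (\<Sum>j<length w. L (take j w))"

definition alive :: "(cell \<Rightarrow> real) \<Rightarrow> real \<Rightarrow> cell \<Rightarrow> bool" where
  "alive L t w \<longleftrightarrow> birth L w \<le> t \<and> t < birth L w + L w"

definition alive_set :: "(cell \<Rightarrow> real) \<Rightarrow> real \<Rightarrow> cell set" where
  "alive_set L t = {w. alive L t w}"

definition first_time :: "(cell \<Rightarrow> real) \<Rightarrow> nat \<Rightarrow> real" where
  "first_time L n = Inf {t. 0 \<le> t \<and> finite (alive_set L t) \<and> card (alive_set L t) = n}"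

definition genome :: "(nat \<Rightarrow> nucleotide) \<Rightarrow> (cell \<times> nat \<Rightarrow> nat) \<Rightarrow> cell \<Rightarrow> nat \<Rightarrow> nucleotide" where
  "genome u Z w i = fold (\<lambda>j v. mutate v (Z (take (Suc j) w, i))) [0..<length w] (u i)"

definition mutant_count :: "(nat \<Rightarrow> nucleotide) \<Rightarrow> nat \<Rightarrow> omega \<Rightarrow> nat \<Rightarrow> nat" where
  "mutant_count u n \<omega> i =
     card {w \<in> alive_set (fst \<omega>) (first_time (fst \<omega>) n). genome u (snd \<omega>) w i \<noteq> u i}"

definition ld_jump_pmf :: "nat pmf" where
  "ld_jump_pmf = embed_pmf (\<lambda>j. if j = 0 then 0 else 1 / (real j * (real j + 1)))"

fun ld_sum :: "nat \<Rightarrow> nat pmf" where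
  "ld_sum 0 = return_pmf 0"
| "ld_sum (Suc k) = bind_pmf (ld_sum k) (\<lambda>s. map_pmf (\<lambda>y. s + y) ld_jump_pmf)"

text \<open>Poisson(c) for c \<ge> 0 (the library's poisson_pmf needs c > 0; Poisson(0) is the point mass at 0).\<close>
definition poisson0_pmf :: "real \<Rightarrow> nat pmf" where
  "poisson0_pmf c = (if c = 0 then return_pmf 0 else poisson_pmf c)"

definition luria_delbrueck :: "real \<Rightarrow> nat pmf" where
  "luria_delbrueck c = bind_pmf (poisson0_pmf c) ld_sum"

end

theory Submission
  imports Defs "HOL-Library.Sublist"
begin

text \<open>By memorylessness the cells alive when the population first reaches size \<open>n\<close> are the leaves
  of a Yule tree: starting from the root, a uniformly chosen leaf is split \<open>n - 1\<close> times. Such a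
  tree has \<open>2 n - 2\<close> non-root nodes, and a second moment recursion shows that the fraction of those
  with \<open>j\<close> leaves below them concentrates around \<open>1 / (j (j + 1))\<close>.

  For a fixed tree the sites are independent, and at one site each non-root node mutates with
  probability \<open>\<mu>\<close>. Unless two mutations lie on one line of descent, which has probability
  \<open>O(\<mu>\<^sup>2 n sqrt n)\<close> on average, the number of mutants is the sum of the clone sizes of the mutated nodes.
  The generating function of that sum is a product over the nodes, close to
  \<open>exp (- 2 \<theta> (1 - \<phi> s))\<close>, where \<open>\<phi>\<close> is the generating function of the jump law; this is the
  generating function of the Luria--Delbrueck law. Finitely many values of the generating function
  of the empirical measure control its integrals of finitely many bounded functions.\<close>

section \<open>Exponential lifetimes and the jump chain\<close>

abbreviation exp1 :: "real measure" where
  "exp1 \<equiv> density lborel (exponential_density 1)"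

lemma prob_space_exp1: "prob_space exp1"
  by (rule prob_space_exponential_density) simp

lemma prob_space_lifetime: "prob_space lifetime_space"
  unfolding lifetime_space_def by (rule prob_space_PiM) (rule prob_space_exp1)

lemma sets_lifetime [measurable_cong]: "sets lifetime_space = sets (PiM UNIV (\<lambda>_. borel))"
  unfolding lifetime_space_def by (rule sets_PiM_cong) auto

lemma space_lifetime [simp]: "space lifetime_space = UNIV"
  by (simp add: lifetime_space_def space_PiM)

lemma measurable_lifetime_component [measurable]: "(\<lambda>L. L v) \<in> borel_measurable lifetime_space"
  using measurable_component_singleton[of v UNIV "\<lambda>_. borel :: real measure"]
  by (simp cong: measurable_cong_sets add: sets_lifetime)

lemma measurable_lifetimeI:
  fixes f :: "'a \<Rightarrow> cell \<Rightarrow> real"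
  assumes "\<And>v. (\<lambda>x. f x v) \<in> borel_measurable M"
  shows "f \<in> measurable M lifetime_space"
  using measurable_PiM_single'[of UNIV "\<lambda>v x. f x v" M "\<lambda>_. borel"] assms
  by (simp cong: measurable_cong_sets add: sets_lifetime)

lemma nn_integral_resample:
  assumes F: "F \<in> borel_measurable lifetime_space"
  shows "(\<integral>\<^sup>+L. F L \<partial>lifetime_space) = (\<integral>\<^sup>+L. \<integral>\<^sup>+x. F (L(v := x)) \<partial>exp1 \<partial>lifetime_space)"
    and "(\<integral>\<^sup>+L. F L \<partial>lifetime_space) = (\<integral>\<^sup>+x. \<integral>\<^sup>+L. F (L(v := x)) \<partial>lifetime_space \<partial>exp1)"
proof -
  interpret E: prob_space exp1 by (rule prob_space_exp1)
  interpret P: prob_space lifetime_space by (rule prob_space_lifetime)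
  interpret EP: pair_sigma_finite exp1 lifetime_space ..
  have upd: "(\<lambda>(x, X). X(v := x)) \<in> measurable (exp1 \<Otimes>\<^sub>M lifetime_space) lifetime_space"
  proof (rule measurable_lifetimeI)
    show "(\<lambda>x. (case x of (x, X) \<Rightarrow> X(v := x)) w) \<in> borel_measurable (exp1 \<Otimes>\<^sub>M lifetime_space)" for w
      by (cases "w = v") (auto simp: split_beta')
  qed
  have "lifetime_space = distr (exp1 \<Otimes>\<^sub>M lifetime_space) lifetime_space (\<lambda>(x, X). X(v := x))"
    using distr_pair_PiM_eq_PiM[of UNIV "\<lambda>_. exp1" v] prob_space_exp1
    by (simp add: lifetime_space_def)
  then have "(\<integral>\<^sup>+L. F L \<partial>lifetime_space)
      = (\<integral>\<^sup>+L. F L \<partial>distr (exp1 \<Otimes>\<^sub>M lifetime_space) lifetime_space (\<lambda>(x, X). X(v := x)))"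
    by simp
  also have "\<dots> = (\<integral>\<^sup>+z. F ((snd z)(v := fst z)) \<partial>(exp1 \<Otimes>\<^sub>M lifetime_space))"
    by (subst nn_integral_distr[OF upd]) (use F in \<open>auto simp: split_beta'\<close>)
  finally have eq: "(\<integral>\<^sup>+L. F L \<partial>lifetime_space) = \<dots>" .
  have m: "(\<lambda>z. F ((snd z)(v := fst z))) \<in> borel_measurable (exp1 \<Otimes>\<^sub>M lifetime_space)"
    using measurable_comp[OF upd F] by (simp add: split_beta' comp_def)
  show "(\<integral>\<^sup>+L. F L \<partial>lifetime_space) = (\<integral>\<^sup>+L. \<integral>\<^sup>+x. F (L(v := x)) \<partial>exp1 \<partial>lifetime_space)"
    unfolding eq using EP.nn_integral_snd[of "\<lambda>z. F ((snd z)(v := fst z))"] m by (simp add: split_beta')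
  show "(\<integral>\<^sup>+L. F L \<partial>lifetime_space) = (\<integral>\<^sup>+x. \<integral>\<^sup>+L. F (L(v := x)) \<partial>lifetime_space \<partial>exp1)"
    unfolding eq using P.nn_integral_fst[OF m] by simp
qed

lemma nn_integral_exp1:
  assumes [measurable]: "g \<in> borel_measurable borel"
  shows "(\<integral>\<^sup>+x. g x \<partial>exp1) = (\<integral>\<^sup>+x. ennreal (exp (- x)) * indicator {0<..} x * g x \<partial>lborel)"
proof -
  have "(\<integral>\<^sup>+x. g x \<partial>exp1) = (\<integral>\<^sup>+x. ennreal (exponential_density 1 x) * g x \<partial>lborel)"
    by (rule nn_integral_density) simp_all
  also have "\<dots> = (\<integral>\<^sup>+x. ennreal (exp (- x)) * indicator {0<..} x * g x \<partial>lborel)"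
  proof (rule nn_integral_cong_AE, use AE_lborel_singleton[of "0::real"] in eventually_elim)
    fix x :: real assume "x \<noteq> 0"
    then show "ennreal (exponential_density 1 x) * g x = ennreal (exp (- x)) * indicator {0<..} x * g x"
      by (auto simp: exponential_density_def indicator_def)
  qed
  finally show ?thesis .
qed

lemma exp1_memoryless:
  assumes [measurable]: "g \<in> borel_measurable borel" and "r \<ge> 0"
  shows "(\<integral>\<^sup>+x. indicator {r<..} x * g (x - r) \<partial>exp1) = ennreal (exp (- r)) * (\<integral>\<^sup>+x. g x \<partial>exp1)"
proof -
  have "(\<integral>\<^sup>+x. indicator {r<..} x * g (x - r) \<partial>exp1)
      = (\<integral>\<^sup>+x. ennreal (exp (- x)) * indicator {0<..} x * (indicator {r<..} x * g (x - r)) \<partial>lborel)"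
    by (rule nn_integral_exp1) simp
  also have "\<dots> = (\<integral>\<^sup>+x. ennreal (exp (- (r + x))) * indicator {0<..} (r + x) * (indicator {r<..} (r + x) * g (r + x - r)) \<partial>lborel)"
    by (subst nn_integral_real_affine[where c=1 and t=r]) simp_all
  also have "\<dots> = (\<integral>\<^sup>+x. ennreal (exp (- r)) * (ennreal (exp (- x)) * indicator {0<..} x * g x) \<partial>lborel)"
    using \<open>r \<ge> 0\<close> by (intro nn_integral_cong)
      (auto simp: indicator_def mult_exp_exp ennreal_mult[symmetric] mult.assoc[symmetric])
  also have "\<dots> = ennreal (exp (- r)) * (\<integral>\<^sup>+x. g x \<partial>exp1)"
    by (subst nn_integral_cmult) (simp_all add: nn_integral_exp1)
  finally show ?thesis .
qed

lemma exp1_rescale: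
  assumes [measurable]: "g \<in> borel_measurable borel" and "c > 0"
  shows "(\<integral>\<^sup>+x. ennreal (exp (- ((c - 1) * x))) * g (c * x) \<partial>exp1)
    = ennreal (1 / c) * (\<integral>\<^sup>+x. g x \<partial>exp1)"
proof -
  have "(\<integral>\<^sup>+x. g x \<partial>exp1)
      = c * (\<integral>\<^sup>+x. ennreal (exp (- (c * x))) * indicator {0<..} (c * x) * g (c * x) \<partial>lborel)"
    unfolding nn_integral_exp1[OF assms(1)]
    using \<open>c > 0\<close> by (subst nn_integral_real_affine[where c=c and t=0]) simp_all
  then have "ennreal (1 / c) * (\<integral>\<^sup>+x. g x \<partial>exp1)
      = (\<integral>\<^sup>+x. ennreal (exp (- (c * x))) * indicator {0<..} (c * x) * g (c * x) \<partial>lborel)"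
    using \<open>c > 0\<close> by (simp add: mult.assoc[symmetric] ennreal_mult[symmetric])
  also have "\<dots> = (\<integral>\<^sup>+x. ennreal (exp (- x)) * indicator {0<..} x * (ennreal (exp (- ((c - 1) * x))) * g (c * x)) \<partial>lborel)"
  proof (rule nn_integral_cong)
    fix x
    have "- (c * x) = - x + - ((c - 1) * x)" by (simp add: algebra_simps)
    then have "ennreal (exp (- (c * x))) = ennreal (exp (- x)) * ennreal (exp (- ((c - 1) * x)))"
      by (simp only: exp_add ennreal_mult exp_ge_zero)
    moreover have "indicator {0<..} (c * x) = (indicator {0<..} x :: ennreal)"
      using \<open>c > 0\<close> by (simp add: indicator_def zero_less_mult_iff)
    ultimately show "ennreal (exp (- (c * x))) * indicator {0<..} (c * x) * g (c * x) =
        ennreal (exp (- x)) * indicator {0<..} x * (ennreal (exp (- ((c - 1) * x))) * g (c * x))"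
      by (simp add: mult_ac)
  qed
  also have "\<dots> = (\<integral>\<^sup>+x. ennreal (exp (- ((c - 1) * x))) * g (c * x) \<partial>exp1)"
    by (rule nn_integral_exp1[symmetric]) simp
  finally show ?thesis by simp
qed

lemma measurable_upd [measurable]:
  "f \<in> measurable M lifetime_space \<Longrightarrow> g \<in> borel_measurable M \<Longrightarrow>
    (\<lambda>x. (f x)(v := g x)) \<in> measurable M lifetime_space"
proof (rule measurable_lifetimeI)
  fix w assume [measurable]: "f \<in> measurable M lifetime_space" "g \<in> borel_measurable M"
  show "(\<lambda>x. ((f x)(v := g x)) w) \<in> borel_measurable M"
    by (cases "w = v") auto
qed

lemma lifetime_memoryless1:
  assumes F [measurable]: "F \<in> borel_measurable lifetime_space" and r: "r \<ge> 0"
  shows "(\<integral>\<^sup>+L. indicator {r<..} (L v) * F (L(v := L v - r)) \<partial>lifetime_space)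
    = ennreal (exp (- r)) * (\<integral>\<^sup>+L. F L \<partial>lifetime_space)"
proof -
  interpret E: prob_space exp1 by (rule prob_space_exp1)
  have "(\<integral>\<^sup>+L. indicator {r<..} (L v) * F (L(v := L v - r)) \<partial>lifetime_space)
     = (\<integral>\<^sup>+L. \<integral>\<^sup>+x. indicator {r<..} x * F (L(v := x - r)) \<partial>exp1 \<partial>lifetime_space)"
    by (subst nn_integral_resample(1)[where v=v]) simp_all
  also have "\<dots> = (\<integral>\<^sup>+L. ennreal (exp (- r)) * (\<integral>\<^sup>+x. F (L(v := x)) \<partial>exp1) \<partial>lifetime_space)"
    by (intro nn_integral_cong exp1_memoryless r) simp
  also have "\<dots> = ennreal (exp (- r)) * (\<integral>\<^sup>+L. \<integral>\<^sup>+x. F (L(v := x)) \<partial>exp1 \<partial>lifetime_space)"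
    by (rule nn_integral_cmult) measurable
  also have "\<dots> = ennreal (exp (- r)) * (\<integral>\<^sup>+L. F L \<partial>lifetime_space)"
    by (subst nn_integral_resample(1)[where v=v]) simp_all
  finally show ?thesis .
qed

definition age :: "cell set \<Rightarrow> real \<Rightarrow> (cell \<Rightarrow> real) \<Rightarrow> (cell \<Rightarrow> real)" where
  "age A r L = (\<lambda>v. if v \<in> A then L v - r else L v)"

lemma measurable_age [measurable]:
  assumes [measurable]: "f \<in> measurable M lifetime_space" "g \<in> borel_measurable M"
  shows "(\<lambda>x. age A (g x) (f x)) \<in> measurable M lifetime_space"
  by (rule measurable_lifetimeI) (auto simp: age_def)

lemma lifetime_memoryless:
  assumes "finite A" and F: "F \<in> borel_measurable lifetime_space" and r: "r \<ge> 0"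
  shows "(\<integral>\<^sup>+L. (\<Prod>v\<in>A. indicator {r<..} (L v)) * F (age A r L) \<partial>lifetime_space)
    = ennreal (exp (- (real (card A) * r))) * (\<integral>\<^sup>+L. F L \<partial>lifetime_space)"
  using assms(1) F
proof (induction A arbitrary: F rule: finite_induct)
  case empty
  then show ?case by (simp add: age_def)
next
  case (insert v A)
  note [measurable] = \<open>F \<in> borel_measurable lifetime_space\<close>
  have age: "age (insert v A) r L = (age A r L)(v := age A r L v - r)" "age A r L v = L v" for L
    using insert.hyps by (auto simp: age_def fun_eq_iff)
  have "(\<integral>\<^sup>+L. (\<Prod>v\<in>insert v A. indicator {r<..} (L v)) * F (age (insert v A) r L) \<partial>lifetime_space)
     = (\<integral>\<^sup>+L. (\<Prod>v\<in>A. indicator {r<..} (L v)) *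
          (indicator {r<..} (age A r L v) * F ((age A r L)(v := age A r L v - r))) \<partial>lifetime_space)"
    using insert.hyps by (intro nn_integral_cong) (simp add: age mult_ac)
  also have "\<dots> = ennreal (exp (- (real (card A) * r))) *
      (\<integral>\<^sup>+L. indicator {r<..} (L v) * F (L(v := L v - r)) \<partial>lifetime_space)"
    by (rule insert.IH[where F="\<lambda>L. indicator {r<..} (L v) * F (L(v := L v - r))"]) measurable
  also have "\<dots> = ennreal (exp (- (real (card (insert v A)) * r))) * (\<integral>\<^sup>+L. F L \<partial>lifetime_space)"
  proof -
    have "- (real (card (insert v A)) * r) = - (real (card A) * r) + - r"
      using insert.hyps by (simp add: algebra_simps)
    then have "ennreal (exp (- (real (card (insert v A)) * r)))
        = ennreal (exp (- (real (card A) * r))) * ennreal (exp (- r))"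
      by (simp only: exp_add ennreal_mult exp_ge_zero)
    then show ?thesis
      by (simp only: lifetime_memoryless1[OF \<open>F \<in> borel_measurable lifetime_space\<close> r] mult.assoc)
  qed
  finally show ?case .
qed

definition strict_min :: "cell set \<Rightarrow> (cell \<Rightarrow> real) \<Rightarrow> cell \<Rightarrow> bool" where
  "strict_min T L w \<longleftrightarrow> w \<in> T \<and> (\<forall>v\<in>T - {w}. L w < L v)"

text \<open>The remaining lifetimes after the first death. The factor \<^term>\<open>card T\<close> makes the
  slot of the dying cell Exp(1)-distributed again, so that the law is reproduced exactly.\<close>
definition residual :: "cell set \<Rightarrow> cell \<Rightarrow> (cell \<Rightarrow> real) \<Rightarrow> (cell \<Rightarrow> real)" where
  "residual T w L = (age (T - {w}) (L w) L)(w := real (card T) * L w)"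

lemma measurable_residual [measurable]:
  "residual T w \<in> measurable lifetime_space lifetime_space"
  unfolding residual_def[abs_def] by measurable

lemma strict_min_indicator:
  assumes "finite T" "w \<in> T"
  shows "(indicator {L. strict_min T L w} L :: ennreal) = (\<Prod>v\<in>T - {w}. indicator {L w<..} (L v))"
proof (cases "\<forall>v\<in>T - {w}. L w < L v")
  case True then show ?thesis using assms by (simp add: strict_min_def)
next
  case False
  then obtain v where "v \<in> T - {w}" "\<not> L w < L v" by auto
  then have "(\<Prod>v\<in>T - {w}. indicator {L w<..} (L v)) = (0::ennreal)"
    using assms by (intro prod_zero bexI[of _ v]) auto
  then show ?thesis using False by (auto simp: strict_min_def)
qed

lemma nn_integral_first_death:
  assumes T: "finite T" "w \<in> T" and F [measurable]: "F \<in> borel_measurable lifetime_space"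
  shows "(\<integral>\<^sup>+L. indicator {L. strict_min T L w} L * F (residual T w L) \<partial>lifetime_space)
    = ennreal (1 / card T) * (\<integral>\<^sup>+L. F L \<partial>lifetime_space)"
proof -
  interpret P: prob_space lifetime_space by (rule prob_space_lifetime)
  interpret E: prob_space exp1 by (rule prob_space_exp1)
  interpret EP: pair_sigma_finite exp1 lifetime_space ..
  define A where "A = T - {w}"
  have A: "finite A" "w \<notin> A" "card T = Suc (card A)"
    using T card.remove[of T w] by (auto simp: A_def)
  have nonneg: "AE x in exp1. x \<ge> 0"
    by (subst AE_density) (auto simp: exponential_density_def)
  have "(\<integral>\<^sup>+L. indicator {L. strict_min T L w} L * F (residual T w L) \<partial>lifetime_space)
      = (\<integral>\<^sup>+L. (\<Prod>v\<in>A. indicator {L w<..} (L v)) * F (residual T w L) \<partial>lifetime_space)"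
    using strict_min_indicator[OF T] by (simp add: A_def)
  also have "\<dots> = (\<integral>\<^sup>+x. \<integral>\<^sup>+L. (\<Prod>v\<in>A. indicator {x<..} (L v)) *
      F ((age A x L)(w := real (card T) * x)) \<partial>lifetime_space \<partial>exp1)"
  proof (subst nn_integral_resample(2)[where v=w])
    have [simp]: "(\<Prod>v\<in>A. indicator {x<..} (if v = w then x else L v)) = (\<Prod>v\<in>A. indicator {x<..} (L v) :: ennreal)" for x L
      using A by (intro prod.cong) auto
    have [simp]: "residual T w (L(w := x)) = (age A x L)(w := real (card T) * x)" for x L
      by (auto simp: residual_def age_def A_def)
    show "(\<integral>\<^sup>+x. \<integral>\<^sup>+L. (\<Prod>v\<in>A. indicator {(L(w := x)) w<..} ((L(w := x)) v)) * F (residual T w (L(w := x))) \<partial>lifetime_space \<partial>exp1)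
      = (\<integral>\<^sup>+x. \<integral>\<^sup>+L. (\<Prod>v\<in>A. indicator {x<..} (L v)) *
      F ((age A x L)(w := real (card T) * x)) \<partial>lifetime_space \<partial>exp1)"
      by simp
    show "(\<lambda>L. (\<Prod>v\<in>A. indicator {L w<..} (L v)) * F (residual T w L)) \<in> borel_measurable lifetime_space"
    proof (intro borel_measurable_times_ennreal borel_measurable_prod_ennreal)
      fix v
      have "(\<lambda>L. indicator {L w<..} (L v) :: ennreal) = indicator {L \<in> space lifetime_space. L w < L v}"
        by (auto simp: indicator_def fun_eq_iff)
      also have "\<dots> \<in> borel_measurable lifetime_space" by measurable
      finally show "(\<lambda>L. indicator {L w<..} (L v) :: ennreal) \<in> borel_measurable lifetime_space" .
    qed measurable
  qed
  also have "\<dots> = (\<integral>\<^sup>+x. ennreal (exp (- ((real (card T) - 1) * x))) *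
      (\<integral>\<^sup>+L. F (L(w := real (card T) * x)) \<partial>lifetime_space) \<partial>exp1)"
  proof (rule nn_integral_cong_AE, use nonneg in eventually_elim)
    fix x :: real assume "0 \<le> x"
    then show "(\<integral>\<^sup>+L. (\<Prod>v\<in>A. indicator {x<..} (L v)) * F ((age A x L)(w := real (card T) * x)) \<partial>lifetime_space)
      = ennreal (exp (- ((real (card T) - 1) * x))) * (\<integral>\<^sup>+L. F (L(w := real (card T) * x)) \<partial>lifetime_space)"
      using lifetime_memoryless[of A "\<lambda>L. F (L(w := real (card T) * x))" x] A by simp
  qed
  also have "\<dots> = ennreal (1 / card T) * (\<integral>\<^sup>+x. \<integral>\<^sup>+L. F (L(w := x)) \<partial>lifetime_space \<partial>exp1)"
    by (rule exp1_rescale) (use A in \<open>measurable, simp\<close>)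
  also have "\<dots> = ennreal (1 / card T) * (\<integral>\<^sup>+L. F L \<partial>lifetime_space)"
    by (simp only: nn_integral_resample(2)[OF F, of w])
  finally show ?thesis .
qed

definition split_leaf :: "cell set \<Rightarrow> cell \<Rightarrow> cell set" where
  "split_leaf T w = insert (w @ [False]) (insert (w @ [True]) (T - {w}))"

fun yule_tree :: "nat \<Rightarrow> cell set pmf" where
  "yule_tree 0 = return_pmf {[]}"
| "yule_tree (Suc n) = bind_pmf (yule_tree n) (\<lambda>T. map_pmf (split_leaf T) (pmf_of_set T))"

definition leaf_set :: "cell set \<Rightarrow> bool" where
  "leaf_set T \<longleftrightarrow> finite T \<and> T \<noteq> {} \<and> (\<forall>x\<in>T. \<forall>y\<in>T. prefix x y \<longrightarrow> x = y) \<and>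
     (\<forall>v. \<exists>x\<in>T. prefix x v \<or> prefix v x)"

lemma leaf_set_root: "leaf_set {[]}"
  by (auto simp: leaf_set_def)

lemma leaf_setD:
  assumes "leaf_set T"
  shows "finite T" "T \<noteq> {}" "\<And>x y. x \<in> T \<Longrightarrow> y \<in> T \<Longrightarrow> prefix x y \<Longrightarrow> x = y"
    "\<And>v. \<exists>x\<in>T. prefix x v \<or> prefix v x"
  using assms unfolding leaf_set_def by blast+

lemma leaf_set_child:
  assumes "leaf_set T" "w \<in> T"
  shows "w @ [b] \<notin> T"
  using leaf_setD(3)[OF assms(1,2), of "w @ [b]"] by auto

lemma prefix_snoc_cases: "prefix x (w @ [b]) \<longleftrightarrow> prefix x w \<or> x = w @ [b]"
  by (auto simp: prefix_snoc)

lemma strict_prefix_child: "strict_prefix w x \<Longrightarrow> \<exists>b. prefix (w @ [b]) x"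
  by (metis append_Cons append_Nil append_assoc prefixI strict_prefixE')

lemma leaf_set_split:
  assumes T: "leaf_set T" and w: "w \<in> T"
  shows "leaf_set (split_leaf T w)" "card (split_leaf T w) = Suc (card T)"
proof -
  note D = leaf_setD[OF T]
  have new: "w @ [b] \<notin> T" for b by (rule leaf_set_child[OF assms])
  have old: "x \<in> T \<Longrightarrow> x \<noteq> w \<Longrightarrow> \<not> prefix x (w @ [b])" "x \<in> T \<Longrightarrow> x \<noteq> w \<Longrightarrow> \<not> prefix (w @ [b]) x" for x b
    using D(3)[of x w] D(3)[of w x] w new[of b]
    by (auto simp: prefix_snoc_cases dest: append_prefixD)
  have "\<exists>x\<in>split_leaf T w. prefix x v \<or> prefix v x" for v
  proof -
    obtain x where x: "x \<in> T" "prefix x v \<or> prefix v x" using D(4) by blast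
    show ?thesis
    proof (cases "x = w")
      case False then show ?thesis using x by (auto simp: split_leaf_def)
    next
      case True
      show ?thesis
      proof (cases "prefix v w")
        case True then have "prefix v (w @ [False])" by (simp add: prefix_snoc_cases)
        then show ?thesis by (auto simp: split_leaf_def)
      next
        case False
        then have "strict_prefix w v" using x \<open>x = w\<close> by (auto simp: strict_prefix_def)
        then obtain b where "prefix (w @ [b]) v" using strict_prefix_child by blast
        then show ?thesis by (cases b) (auto simp: split_leaf_def)
      qed
    qed
  qed
  moreover have "\<forall>x\<in>split_leaf T w. \<forall>y\<in>split_leaf T w. prefix x y \<longrightarrow> x = y"
    using D(3) old unfolding split_leaf_def by (auto simp: prefix_snoc_cases)
  moreover have "finite (split_leaf T w)" "split_leaf T w \<noteq> {}"
    using D(1) by (auto simp: split_leaf_def)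
  ultimately show "leaf_set (split_leaf T w)"
    unfolding leaf_set_def by blast
  show "card (split_leaf T w) = Suc (card T)"
    using D(1) w new card.remove[of T w] by (simp add: split_leaf_def)
qed



lemma yule_tree_leaf_set:
  "T \<in> set_pmf (yule_tree n) \<Longrightarrow> leaf_set T \<and> card T = Suc n"
proof (induction n arbitrary: T)
  case 0 then show ?case by (simp add: leaf_set_root)
next
  case (Suc n)
  then obtain S where S: "S \<in> set_pmf (yule_tree n)" "T \<in> split_leaf S ` set_pmf (pmf_of_set S)"
    by auto
  then have "leaf_set S" "card S = Suc n" using Suc.IH by auto
  then show ?case
    using S leaf_setD(1,2)[of S] leaf_set_split[of S] by (auto simp: set_pmf_of_set)
qed

lemma split_mem_yule_tree:
  assumes "T \<in> set_pmf (yule_tree n)" "w \<in> T"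
  shows "split_leaf T w \<in> set_pmf (yule_tree (Suc n))"
proof -
  have "set_pmf (pmf_of_set T) = T"
    using yule_tree_leaf_set[OF assms(1)] leaf_setD(1,2)[of T] by (simp add: set_pmf_of_set)
  then show ?thesis using assms by auto
qed

lemma finite_set_yule_tree: "finite (set_pmf (yule_tree n))"
proof (induction n)
  case (Suc n)
  have "finite (set_pmf (map_pmf (split_leaf T) (pmf_of_set T)))" if "T \<in> set_pmf (yule_tree n)" for T
    using leaf_setD(1,2)[of T] yule_tree_leaf_set[OF that] by (simp add: set_pmf_of_set)
  then show ?case using Suc by simp
qed simp

definition death_step :: "cell set \<times> (cell \<Rightarrow> real) \<Rightarrow> cell set \<times> (cell \<Rightarrow> real)" where
  "death_step = (\<lambda>(T, L). if \<exists>w. strict_min T L w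
     then (split_leaf T (THE w. strict_min T L w), residual T (THE w. strict_min T L w) L)
     else (T, L))"

definition jump_state :: "nat \<Rightarrow> (cell \<Rightarrow> real) \<Rightarrow> cell set \<times> (cell \<Rightarrow> real)" where
  "jump_state n L = (death_step ^^ n) ({[]}, L)"

lemma jump_state_simps [simp]:
  "jump_state 0 L = ({[]}, L)" "jump_state (Suc n) L = death_step (jump_state n L)"
  by (simp_all add: jump_state_def)

lemma strict_min_unique: "strict_min T L w \<Longrightarrow> strict_min T L w' \<Longrightarrow> w = w'"
  unfolding strict_min_def by (metis DiffI less_asym singletonD)

lemma The_strict_min: "strict_min T L w \<Longrightarrow> (THE w. strict_min T L w) = w"
  using strict_min_unique by blast

lemma death_step_strict_min:
  "strict_min T L w \<Longrightarrow> death_step (T, L) = (split_leaf T w, residual T w L)"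
  unfolding death_step_def by (auto simp: The_strict_min)

lemma measurable_strict_min [measurable]:
  assumes "finite T"
  shows "Measurable.pred lifetime_space (\<lambda>L. strict_min T L w)"
  unfolding strict_min_def using assms by measurable

definition apply_step :: "(cell set \<Rightarrow> (cell \<Rightarrow> real) \<Rightarrow> ennreal) \<Rightarrow> cell set \<Rightarrow> (cell \<Rightarrow> real) \<Rightarrow> ennreal" where
  "apply_step \<Phi> T L = (case death_step (T, L) of (T', L') \<Rightarrow> \<Phi> T' L')"

lemma apply_step_eq:
  assumes "finite T"
  shows "apply_step \<Phi> T L =
    (\<Sum>w\<in>T. indicator {L. strict_min T L w} L * \<Phi> (split_leaf T w) (residual T w L)) +
    indicator {L. \<nexists>w. strict_min T L w} L * \<Phi> T L"
proof (cases "\<exists>w. strict_min T L w")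
  case True
  then obtain w where w: "strict_min T L w" by blast
  have "(\<Sum>w\<in>T. indicator {L. strict_min T L w} L * \<Phi> (split_leaf T w) (residual T w L))
      = (\<Sum>v\<in>T. if v = w then \<Phi> (split_leaf T w) (residual T w L) else 0)"
    using w strict_min_unique by (intro sum.cong) (auto simp: indicator_def)
  also have "\<dots> = \<Phi> (split_leaf T w) (residual T w L)"
    using w assms by (simp add: strict_min_def)
  finally show ?thesis using w by (auto simp: apply_step_def death_step_strict_min indicator_def)
next
  case False
  then show ?thesis by (auto simp: apply_step_def death_step_def strict_min_def)
qed

lemma measurable_apply_step:
  assumes \<Phi>: "\<And>T. finite T \<Longrightarrow> \<Phi> T \<in> borel_measurable lifetime_space" and T: "finite T"
  shows "apply_step \<Phi> T \<in> borel_measurable lifetime_space"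
proof -
  have [measurable]: "\<Phi> T \<in> borel_measurable lifetime_space"
    "\<Phi> (split_leaf T w) \<in> borel_measurable lifetime_space" for w
    using T by (auto intro!: \<Phi> simp: split_leaf_def)
  note [measurable] = measurable_strict_min[OF T]
  have "(\<exists>w. strict_min T L w) \<longleftrightarrow> (\<exists>w\<in>T. strict_min T L w)" for L
    by (auto simp: strict_min_def)
  then have [measurable]: "Measurable.pred lifetime_space (\<lambda>L. \<exists>w. strict_min T L w)"
    using T by simp
  show ?thesis
    unfolding apply_step_eq[OF T, abs_def] by measurable
qed

lemma AE_lifetime_distinct:
  assumes "v \<noteq> w"
  shows "AE L in lifetime_space. L v \<noteq> L w"
proof -
  have *: "AE x in exp1. x \<noteq> c" for c
    by (subst AE_density) (use AE_lborel_singleton[of c] in auto)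
  have null: "(\<integral>\<^sup>+x. indicator {c} x \<partial>exp1) = 0" for c
    using *[of c] by (subst nn_integral_0_iff_AE) (auto simp: indicator_def)
  have "{L \<in> space lifetime_space. L v = L w} \<in> sets lifetime_space" by measurable
  then have m: "(\<lambda>L. indicator {L w} (L v) :: ennreal) \<in> borel_measurable lifetime_space"
    by (subst measurable_cong[where g="indicator {L \<in> space lifetime_space. L v = L w}"])
       (auto simp: indicator_def)
  have "(\<integral>\<^sup>+L. indicator {L w} (L v) \<partial>lifetime_space) = (0::ennreal)"
    using assms by (subst nn_integral_resample(1)[where v=v, OF m]) (simp add: null)
  then show ?thesis
    by (subst (asm) nn_integral_0_iff_AE[OF m]) (auto simp: indicator_def elim: eventually_mono split: if_splits)
qed

lemma AE_strict_min:
  assumes "finite T" "T \<noteq> {}"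
  shows "AE L in lifetime_space. \<exists>w. strict_min T L w"
proof -
  have "AE L in lifetime_space. \<forall>v\<in>T. \<forall>w\<in>T. v \<noteq> w \<longrightarrow> L v \<noteq> L w"
    using assms AE_lifetime_distinct by (auto simp: AE_finite_all)
  then show ?thesis
  proof eventually_elim
    fix L :: "cell \<Rightarrow> real" assume L: "\<forall>v\<in>T. \<forall>w\<in>T. v \<noteq> w \<longrightarrow> L v \<noteq> L w"
    obtain w where w: "w \<in> T" "\<forall>v\<in>T. L w \<le> L v"
      using assms by (meson arg_min_if_finite(1) arg_min_least)
    then have "strict_min T L w" unfolding strict_min_def using L by force
    then show "\<exists>w. strict_min T L w" ..
  qed
qed

lemma nn_integral_apply_step:
  assumes \<Phi>: "\<And>T. finite T \<Longrightarrow> \<Phi> T \<in> borel_measurable lifetime_space" and T: "finite T" "T \<noteq> {}"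
  shows "(\<integral>\<^sup>+L. apply_step \<Phi> T L \<partial>lifetime_space)
    = (\<integral>\<^sup>+w. \<integral>\<^sup>+L. \<Phi> (split_leaf T w) L \<partial>lifetime_space \<partial>pmf_of_set T)"
proof -
  have m [measurable]: "\<Phi> (split_leaf T w) \<in> borel_measurable lifetime_space" for w
    using T by (auto intro!: \<Phi> simp: split_leaf_def)
  note [measurable] = measurable_strict_min[OF T(1)]
  have "(\<integral>\<^sup>+L. apply_step \<Phi> T L \<partial>lifetime_space)
     = (\<integral>\<^sup>+L. (\<Sum>w\<in>T. indicator {L. strict_min T L w} L * \<Phi> (split_leaf T w) (residual T w L)) \<partial>lifetime_space)"
    using AE_strict_min[OF T] unfolding apply_step_eq[OF T(1)]
    by (intro nn_integral_cong_AE) (auto elim!: eventually_mono simp: indicator_def)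
  also have "\<dots> = (\<Sum>w\<in>T. \<integral>\<^sup>+L. indicator {L. strict_min T L w} L * \<Phi> (split_leaf T w) (residual T w L) \<partial>lifetime_space)"
    by (intro nn_integral_sum) measurable
  also have "\<dots> = (\<Sum>w\<in>T. ennreal (1 / card T) * (\<integral>\<^sup>+L. \<Phi> (split_leaf T w) L \<partial>lifetime_space))"
    using T(1) m by (intro sum.cong nn_integral_first_death) auto
  also have "\<dots> = (\<integral>\<^sup>+w. \<integral>\<^sup>+L. \<Phi> (split_leaf T w) L \<partial>lifetime_space \<partial>pmf_of_set T)"
    using T by (subst nn_integral_pmf_of_set)
      (auto simp: sum_distrib_left[symmetric] divide_ennreal_def inverse_ennreal[symmetric] card_gt_0_iff
        mult.commute inverse_eq_divide[symmetric] ennreal_of_nat_eq_real_of_nat)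
  finally show ?thesis .
qed

lemma jump_state_law:
  assumes \<Phi>: "\<And>T. finite T \<Longrightarrow> \<Phi> T \<in> borel_measurable lifetime_space"
  shows "(\<lambda>L. case jump_state n L of (T, R) \<Rightarrow> \<Phi> T R) \<in> borel_measurable lifetime_space \<and>
    (\<integral>\<^sup>+L. (case jump_state n L of (T, R) \<Rightarrow> \<Phi> T R) \<partial>lifetime_space)
      = (\<integral>\<^sup>+T. \<integral>\<^sup>+L. \<Phi> T L \<partial>lifetime_space \<partial>yule_tree n)"
  using \<Phi>
proof (induction n arbitrary: \<Phi>)
  case 0
  then show ?case by simp
next
  case (Suc n)
  have eq: "(case jump_state (Suc n) L of (T, R) \<Rightarrow> \<Phi> T R)
      = (case jump_state n L of (T, R) \<Rightarrow> apply_step \<Phi> T R)" for L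
    by (simp add: apply_step_def split: prod.split)
  have "(\<integral>\<^sup>+T. \<integral>\<^sup>+L. apply_step \<Phi> T L \<partial>lifetime_space \<partial>yule_tree n)
    = (\<integral>\<^sup>+T. \<integral>\<^sup>+w. \<integral>\<^sup>+L. \<Phi> (split_leaf T w) L \<partial>lifetime_space \<partial>pmf_of_set T \<partial>yule_tree n)"
  proof (rule nn_integral_cong_AE, rule AE_pmfI)
    fix T assume "T \<in> set_pmf (yule_tree n)"
    then show "(\<integral>\<^sup>+L. apply_step \<Phi> T L \<partial>lifetime_space)
        = (\<integral>\<^sup>+w. \<integral>\<^sup>+L. \<Phi> (split_leaf T w) L \<partial>lifetime_space \<partial>pmf_of_set T)"
      using yule_tree_leaf_set[of T n] leaf_setD(1,2)[of T] Suc.prems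
      by (intro nn_integral_apply_step) auto
  qed
  then show ?case
    using Suc.IH[of "apply_step \<Phi>"] measurable_apply_step[of \<Phi>] Suc.prems
    unfolding eq by simp
qed

section \<open>The population at the first time of size n\<close>

lemma AE_lifetime_pos: "AE L in lifetime_space. \<forall>v. 0 < L v"
  unfolding AE_all_countable
proof
  fix v
  have null: "(\<integral>\<^sup>+x. indicator {..0} x \<partial>exp1) = 0"
    by (subst nn_integral_exp1) (auto simp: indicator_def nn_integral_0_iff_AE)
  have m: "(\<lambda>L. indicator {..0} (L v) :: ennreal) \<in> borel_measurable lifetime_space"
    by measurable
  have "(\<integral>\<^sup>+L. indicator {..0} (L v) \<partial>lifetime_space) = (0::ennreal)"
    by (subst nn_integral_resample(1)[where v=v, OF m]) (simp add: null)
  then show "AE L in lifetime_space. 0 < L v"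
    by (subst (asm) nn_integral_0_iff_AE[OF m])
       (auto simp: indicator_def not_le elim!: eventually_mono split: if_splits)
qed

definition generic :: "(cell \<Rightarrow> real) \<Rightarrow> bool" where
  "generic L \<longleftrightarrow> (\<forall>v. 0 < L v) \<and>
     (\<forall>n. \<exists>w. strict_min (fst (jump_state n L)) (snd (jump_state n L)) w)"

lemma AE_generic: "AE L in lifetime_space. generic L"
proof -
  have "AE L in lifetime_space. \<exists>w. strict_min (fst (jump_state n L)) (snd (jump_state n L)) w" for n
  proof -
    define \<Phi> :: "cell set \<Rightarrow> (cell \<Rightarrow> real) \<Rightarrow> ennreal"
      where "\<Phi> T L = indicator {L. \<nexists>w. strict_min T L w} L" for T L
    have "\<Phi> T \<in> borel_measurable lifetime_space" if T: "finite T" for T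
    proof -
      have "(\<exists>w. strict_min T L w) \<longleftrightarrow> (\<exists>w\<in>T. strict_min T L w)" for L
        by (auto simp: strict_min_def)
      then have [measurable]: "Measurable.pred lifetime_space (\<lambda>L. \<exists>w. strict_min T L w)"
        using T measurable_strict_min[OF T] by simp
      show ?thesis unfolding \<Phi>_def by measurable
    qed
    note law = jump_state_law[of \<Phi> n, OF this]
    have "(\<integral>\<^sup>+T. \<integral>\<^sup>+L. \<Phi> T L \<partial>lifetime_space \<partial>yule_tree n) = (\<integral>\<^sup>+T. 0 \<partial>yule_tree n)"
    proof (rule nn_integral_cong_AE, rule AE_pmfI)
      fix T assume "T \<in> set_pmf (yule_tree n)"
      then have "AE L in lifetime_space. \<exists>w. strict_min T L w"
        using yule_tree_leaf_set[of T n] leaf_setD(1,2)[of T] AE_strict_min by blast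
      then have "(\<integral>\<^sup>+L. \<Phi> T L \<partial>lifetime_space) = (\<integral>\<^sup>+L. 0 \<partial>lifetime_space)"
        by (intro nn_integral_cong_AE) (auto simp: \<Phi>_def indicator_def elim!: eventually_mono)
      then show "(\<integral>\<^sup>+L. \<Phi> T L \<partial>lifetime_space) = 0" by simp
    qed
    then have "(\<integral>\<^sup>+L. (case jump_state n L of (T, R) \<Rightarrow> \<Phi> T R) \<partial>lifetime_space) = 0"
      by (subst conjunct2[OF law]) (simp_all only: nn_integral_const mult_zero_left)
    then have "AE L in lifetime_space. (case jump_state n L of (T, R) \<Rightarrow> \<Phi> T R) = 0"
      using law by (subst (asm) nn_integral_0_iff_AE) auto
    then show ?thesis
      by eventually_elim (auto simp: \<Phi>_def split_beta' indicator_def split: if_splits)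
  qed
  then have "AE L in lifetime_space. \<forall>n. \<exists>w. strict_min (fst (jump_state n L)) (snd (jump_state n L)) w"
    unfolding AE_all_countable by blast
  then show ?thesis using AE_lifetime_pos by eventually_elim (simp add: generic_def)
qed

lemma emeasure_jump_state:
  shows "{L. fst (jump_state n L) = T} \<in> sets lifetime_space"
    and "emeasure lifetime_space {L. fst (jump_state n L) = T} = pmf (yule_tree n) T"
proof -
  interpret P: prob_space lifetime_space by (rule prob_space_lifetime)
  have law: "(\<lambda>L. case jump_state n L of (T', R) \<Rightarrow> (indicator {T} T' :: ennreal)) \<in> borel_measurable lifetime_space"
    "(\<integral>\<^sup>+L. (case jump_state n L of (T', R) \<Rightarrow> indicator {T} T') \<partial>lifetime_space)
      = (\<integral>\<^sup>+T'. \<integral>\<^sup>+L. indicator {T} T' \<partial>lifetime_space \<partial>yule_tree n)"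
    using jump_state_law[of "\<lambda>T' _. indicator {T} T'" n] by simp_all
  have eq: "(case jump_state n L of (T', R) \<Rightarrow> indicator {T} T') = (indicator {L. fst (jump_state n L) = T} L :: ennreal)" for L
    by (auto simp: split_beta' indicator_def)
  show s: "{L. fst (jump_state n L) = T} \<in> sets lifetime_space"
    using law(1) unfolding eq by (simp add: borel_measurable_indicator_iff)
  show "emeasure lifetime_space {L. fst (jump_state n L) = T} = pmf (yule_tree n) T"
    using law(2) s unfolding eq by (simp add: P.emeasure_space_1[simplified] emeasure_pmf_single)
qed

lemma birth_child: "birth L (v @ [b]) = birth L v + L v"
  by (simp add: birth_def)

lemma birth_mono:
  assumes "\<forall>v. 0 < L v"
  shows "birth L v \<le> birth L (v @ u)"
proof (induction u rule: rev_induct)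
  case (snoc b u)
  then show ?case using assms birth_child[of L "v @ u" b]
    by (simp add: less_imp_le add_increasing2)
qed simp

lemma birth_strict_prefix:
  assumes "\<forall>v. 0 < L v" "strict_prefix v x"
  shows "birth L v + L v \<le> birth L x"
proof -
  obtain b where "prefix (v @ [b]) x" using strict_prefix_child[OF assms(2)] by blast
  then obtain u where "x = (v @ [b]) @ u" by (auto simp: prefix_def)
  then show ?thesis
    using birth_mono[OF assms(1), of "v @ [b]" u] by (simp add: birth_child)
qed

text \<open>Below the leaves, \<^term>\<open>R\<close> records the full lifetimes of the cells not yet born.\<close>
definition snapshot :: "(cell \<Rightarrow> real) \<Rightarrow> real \<Rightarrow> cell set \<Rightarrow> (cell \<Rightarrow> real) \<Rightarrow> bool" where
  "snapshot L t T R \<longleftrightarrow> leaf_set T \<and>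
     (\<forall>v\<in>T. R v = birth L v + L v - t \<and> 0 < R v \<and> birth L v \<le> t) \<and>
     (\<forall>x\<in>T. \<forall>v. strict_prefix x v \<longrightarrow> R v = L v)"

lemma snapshot_step:
  assumes pos: "\<forall>v. 0 < L v" and snap: "snapshot L t T R" and w: "strict_min T R w"
  shows "snapshot L (t + R w) (split_leaf T w) (residual T w R)"
proof -
  have T: "leaf_set T" and R: "\<And>v. v \<in> T \<Longrightarrow> R v = birth L v + L v - t \<and> 0 < R v \<and> birth L v \<le> t"
    and U: "\<And>x v. x \<in> T \<Longrightarrow> strict_prefix x v \<Longrightarrow> R v = L v"
    using snap by (auto simp: snapshot_def)
  have wT: "w \<in> T" and wmin: "\<And>v. v \<in> T \<Longrightarrow> v \<noteq> w \<Longrightarrow> R w < R v"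
    using w by (auto simp: strict_min_def)
  have below: "v \<notin> T" if "x \<in> T" "strict_prefix x v" for x v
    using leaf_setD(3)[OF T, of x v] that by (auto simp: strict_prefix_def)
  have res: "residual T w R v = (if v = w then real (card T) * R w else if v \<in> T then R v - R w else R v)" for v
    by (simp add: residual_def age_def)
  have sw: "strict_prefix w (w @ [b])" for b by (simp add: strict_prefix_def)
  have child: "residual T w R (w @ [b]) = birth L (w @ [b]) + L (w @ [b]) - (t + R w) \<and>
      0 < residual T w R (w @ [b]) \<and> birth L (w @ [b]) \<le> t + R w" for b
    using below[OF wT sw[of b]] U[OF wT sw[of b]] R[OF wT] pos by (simp add: res birth_child)
  have old: "residual T w R v = birth L v + L v - (t + R w) \<and> 0 < residual T w R v \<and> birth L v \<le> t + R w"
    if "v \<in> T" "v \<noteq> w" for v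
    using R[OF that(1)] R[OF wT] wmin[OF that] that by (simp add: res)
  have unborn: "residual T w R v = L v" if "x \<in> T" "strict_prefix x v" for x v
    using below[OF that] U[OF that] wT by (auto simp: res)
  have "residual T w R v = L v" if x: "x \<in> split_leaf T w" "strict_prefix x v" for x v
  proof (cases "x \<in> T")
    case True then show ?thesis using unborn x by blast
  next
    case False
    then obtain b where "x = w @ [b]" using x(1) unfolding split_leaf_def by blast
    then have "strict_prefix w v" using x(2) sw prefix_order.less_trans by blast
    then show ?thesis using unborn wT by blast
  qed
  moreover have "residual T w R v = birth L v + L v - (t + R w) \<and> 0 < residual T w R v \<and> birth L v \<le> t + R w"
    if "v \<in> split_leaf T w" for v
    using that child old[of v] unfolding split_leaf_def by blast
  ultimately show ?thesis
    unfolding snapshot_def using leaf_set_split(1)[OF T wT] by blast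
qed

lemma alive_set_snapshot:
  assumes pos: "\<forall>v. 0 < L v" and snap: "snapshot L t T R" and w: "strict_min T R w"
    and s: "t \<le> s" "s < t + R w"
  shows "alive_set L s = T"
proof -
  have T: "leaf_set T" and R: "\<And>v. v \<in> T \<Longrightarrow> R v = birth L v + L v - t \<and> 0 < R v \<and> birth L v \<le> t"
    using snap by (auto simp: snapshot_def)
  have wmin: "R w \<le> R v" if "v \<in> T" for v
    using w that by (cases "v = w") (auto simp: strict_min_def less_imp_le)
  have "alive L s v \<longleftrightarrow> v \<in> T" for v
  proof
    assume "v \<in> T" then show "alive L s v" using R[of v] wmin[of v] s by (simp add: alive_def)
  next
    assume a: "alive L s v"
    obtain x where x: "x \<in> T" "prefix x v \<or> prefix v x" using leaf_setD(4)[OF T] by blast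
    have "\<not> strict_prefix x v"
      using birth_strict_prefix[OF pos, of x v] a s R[OF x(1)] wmin[OF x(1)] by (auto simp: alive_def)
    moreover have "\<not> strict_prefix v x"
      using birth_strict_prefix[OF pos, of v x] a s R[OF x(1)] by (auto simp: alive_def)
    ultimately show "v \<in> T" using x by (auto simp: strict_prefix_def)
  qed
  then show ?thesis by (auto simp: alive_set_def)
qed

lemma generic_jump_state:
  assumes "generic L"
  shows "fst (jump_state n L) \<in> set_pmf (yule_tree n) \<and>
    (\<exists>t. 0 \<le> t \<and> snapshot L t (fst (jump_state n L)) (snd (jump_state n L)) \<and>
       (\<forall>s. 0 \<le> s \<and> s < t \<longrightarrow> card (alive_set L s) \<le> n))"
proof (induction n)
  case 0
  show ?case using assms
    by (auto intro!: exI[of _ 0] simp: snapshot_def leaf_set_root birth_def generic_def)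
next
  case (Suc n)
  obtain T R where TR: "jump_state n L = (T, R)" by fastforce
  then obtain t where t: "T \<in> set_pmf (yule_tree n)" "0 \<le> t" "snapshot L t T R"
      "\<And>s. 0 \<le> s \<Longrightarrow> s < t \<Longrightarrow> card (alive_set L s) \<le> n"
    using Suc.IH by auto
  have pos: "\<forall>v. 0 < L v" using assms by (simp add: generic_def)
  obtain w where w: "strict_min T R w" using assms TR unfolding generic_def by (metis fst_conv snd_conv)
  have "0 < R w" using t(3) w by (auto simp: snapshot_def strict_min_def)
  have "card (alive_set L s) \<le> Suc n" if "0 \<le> s" "s < t + R w" for s
  proof (cases "s < t")
    case True then show ?thesis using t(4)[of s] that by simp
  next
    case False
    then show ?thesis using alive_set_snapshot[OF pos t(3) w, of s] that yule_tree_leaf_set[OF t(1)] by simp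
  qed
  then show ?case
    using snapshot_step[OF pos t(3) w] split_mem_yule_tree[OF t(1), of w] w t(2) \<open>0 < R w\<close>
    by (auto simp: TR death_step_strict_min strict_min_def simp del: yule_tree.simps intro!: exI[of _ "t + R w"])
qed

lemma alive_set_first_time:
  assumes "generic L"
  shows "alive_set L (first_time L (Suc n)) = fst (jump_state n L)"
proof -
  obtain T R where TR: "jump_state n L = (T, R)" by fastforce
  then obtain t where t: "T \<in> set_pmf (yule_tree n)" "0 \<le> t" "snapshot L t T R"
      "\<And>s. 0 \<le> s \<Longrightarrow> s < t \<Longrightarrow> card (alive_set L s) \<le> n"
    using generic_jump_state[OF assms, of n] by auto
  have pos: "\<forall>v. 0 < L v" using assms by (simp add: generic_def)
  obtain w where w: "strict_min T R w" using assms TR unfolding generic_def by (metis fst_conv snd_conv)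
  have "0 < R w" using t(3) w by (auto simp: snapshot_def strict_min_def)
  then have alive: "alive_set L t = T" using alive_set_snapshot[OF pos t(3) w] by simp
  have T: "finite T" "card T = Suc n" using yule_tree_leaf_set[OF t(1)] leaf_setD(1) by auto
  have "first_time L (Suc n) = t"
    unfolding first_time_def
  proof (rule cInf_eq_minimum)
    show "t \<in> {t. 0 \<le> t \<and> finite (alive_set L t) \<and> card (alive_set L t) = Suc n}"
      using t(2) T alive by simp
    show "t \<le> s" if "s \<in> {t. 0 \<le> t \<and> finite (alive_set L t) \<and> card (alive_set L t) = Suc n}" for s
      using that t(4)[of s] by (cases "s < t") auto
  qed
  then show ?thesis using alive TR by simp
qed

section \<open>Clone sizes in the Yule tree\<close>

definition tree_nodes :: "cell set \<Rightarrow> cell set" where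
  "tree_nodes T = {w. w \<noteq> [] \<and> (\<exists>x\<in>T. prefix w x)}"

definition clone_size :: "cell set \<Rightarrow> cell \<Rightarrow> nat" where
  "clone_size T w = card {x \<in> T. prefix w x}"

lemma finite_tree_nodes: "finite T \<Longrightarrow> finite (tree_nodes T)"
proof -
  assume "finite T"
  moreover have "tree_nodes T \<subseteq> (\<Union>x\<in>T. set (prefixes x))" by (auto simp: tree_nodes_def)
  ultimately show ?thesis by (meson finite_UN_I finite_set finite_subset)
qed

lemma clone_size_pos: "finite T \<Longrightarrow> w \<in> tree_nodes T \<Longrightarrow> clone_size T w > 0"
  by (auto simp: tree_nodes_def clone_size_def card_gt_0_iff)

lemma tree_nodes_split:
  assumes "leaf_set T" "x \<in> T"
  shows "tree_nodes (split_leaf T x) = insert (x @ [False]) (insert (x @ [True]) (tree_nodes T))"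
proof -
  have "w \<in> tree_nodes (split_leaf T x) \<longleftrightarrow> w = x @ [False] \<or> w = x @ [True] \<or> w \<in> tree_nodes T" for w
    using assms(2) by (auto simp: tree_nodes_def split_leaf_def prefix_snoc_cases)
  then show ?thesis by blast
qed

lemma child_notin_nodes:
  assumes "leaf_set T" "x \<in> T"
  shows "x @ [b] \<notin> tree_nodes T"
proof
  assume "x @ [b] \<in> tree_nodes T"
  then obtain y where y: "y \<in> T" "prefix (x @ [b]) y" by (auto simp: tree_nodes_def)
  then have "prefix x y" by (auto dest: append_prefixD)
  then have "x = y" using leaf_setD(3)[OF assms(1)] assms(2) y by blast
  then show False using y(2) by auto
qed

lemma card_tree_nodes_split:
  assumes "leaf_set T" "x \<in> T"
  shows "card (tree_nodes (split_leaf T x)) = card (tree_nodes T) + 2"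
  using assms child_notin_nodes[OF assms] finite_tree_nodes[OF leaf_setD(1)[OF assms(1)]]
  by (simp add: tree_nodes_split)

lemma card_tree_nodes:
  "T \<in> set_pmf (yule_tree n) \<Longrightarrow> card (tree_nodes T) = 2 * n"
proof (induction n arbitrary: T)
  case 0 then show ?case by (simp add: tree_nodes_def)
next
  case (Suc n)
  then obtain S where S: "S \<in> set_pmf (yule_tree n)" "T \<in> split_leaf S ` set_pmf (pmf_of_set S)"
    by auto
  then obtain x where "x \<in> S" "T = split_leaf S x"
    using yule_tree_leaf_set[OF S(1)] leaf_setD(1,2)[of S] by (auto simp: set_pmf_of_set)
  then show ?case using yule_tree_leaf_set[OF S(1)] Suc.IH[OF S(1)] by (simp add: card_tree_nodes_split)
qed

lemma clone_size_split_old: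
  assumes T: "leaf_set T" and x: "x \<in> T" and w: "w \<in> tree_nodes T"
  shows "clone_size (split_leaf T x) w = clone_size T w + of_bool (prefix w x)"
proof -
  have fin: "finite {y \<in> T. prefix w y}" using leaf_setD(1)[OF T] by simp
  have new: "x @ [b] \<notin> T" "w \<noteq> x @ [b]" for b
    using leaf_set_child[OF T x] child_notin_nodes[OF T x] w by auto
  show ?thesis
  proof (cases "prefix w x")
    case True
    then have "{y \<in> split_leaf T x. prefix w y}
        = insert (x @ [False]) (insert (x @ [True]) ({y \<in> T. prefix w y} - {x}))"
      by (auto simp: split_leaf_def prefix_snoc_cases)
    then have "clone_size (split_leaf T x) w = Suc (Suc (card ({y \<in> T. prefix w y} - {x})))"
      using fin new by (simp add: clone_size_def)
    also have "\<dots> = Suc (clone_size T w)"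
      using card.remove[OF fin, of x] x True by (simp add: clone_size_def)
    finally show ?thesis using True by simp
  next
    case False
    then have "{y \<in> split_leaf T x. prefix w y} = {y \<in> T. prefix w y}"
      using new by (auto simp: split_leaf_def prefix_snoc_cases)
    then show ?thesis using False by (simp add: clone_size_def)
  qed
qed

lemma clone_size_split_new:
  assumes T: "leaf_set T" and x: "x \<in> T"
  shows "clone_size (split_leaf T x) (x @ [b]) = 1"
proof -
  have "x @ [b] \<in> split_leaf T x" by (cases b) (auto simp: split_leaf_def)
  then have "{y \<in> split_leaf T x. prefix (x @ [b]) y} = {x @ [b]}"
    using leaf_setD(3)[OF leaf_set_split(1)[OF assms]] by auto
  then show ?thesis by (simp add: clone_size_def)
qed

definition clone_count :: "cell set \<Rightarrow> nat \<Rightarrow> nat" where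
  "clone_count T j = card {w \<in> tree_nodes T. clone_size T w = j}"

definition ancestor_count :: "cell set \<Rightarrow> nat \<Rightarrow> cell \<Rightarrow> nat" where
  "ancestor_count T j x = card {w \<in> tree_nodes T. prefix w x \<and> clone_size T w = j}"

lemma clone_size_strict_mono:
  assumes T: "leaf_set T" and ww: "strict_prefix w w'" and w': "w' \<in> tree_nodes T"
  shows "clone_size T w' < clone_size T w"
proof -
  obtain x where x: "x \<in> T" "prefix w' x" using w' by (auto simp: tree_nodes_def)
  obtain b where b: "prefix (w @ [b]) w'" using strict_prefix_child[OF ww] by blast
  obtain y where y: "y \<in> T" "prefix y (w @ [\<not> b]) \<or> prefix (w @ [\<not> b]) y"
    using leaf_setD(4)[OF T] by blast
  have sub: "{z \<in> T. prefix w' z} \<subseteq> {z \<in> T. prefix w z}"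
    using ww by (auto simp: strict_prefix_def dest: prefix_order.trans)
  have "\<not> prefix y w"
  proof
    assume "prefix y w"
    then have "prefix y x" "prefix y w'" using ww x by (auto simp: strict_prefix_def dest: prefix_order.trans)
    then have "y = x" using leaf_setD(3)[OF T] y x by blast
    then show False using \<open>prefix y w\<close> ww x by (metis prefix_order.less_le_trans prefix_order.leD)
  qed
  then have y': "prefix (w @ [\<not> b]) y" using y by (auto simp: prefix_snoc_cases)
  have "\<not> prefix w' y"
  proof
    assume "prefix w' y"
    then have "prefix (w @ [b]) y" using b prefix_order.trans by blast
    then show False using y' by (auto simp: prefix_def)
  qed
  moreover have "prefix w y" using y' by (auto dest: append_prefixD)
  ultimately have "y \<in> {z \<in> T. prefix w z}" "y \<notin> {z \<in> T. prefix w' z}" using y by auto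
  then have "{z \<in> T. prefix w' z} \<subset> {z \<in> T. prefix w z}" using sub by blast
  then show ?thesis using leaf_setD(1)[OF T] by (auto simp: clone_size_def intro: psubset_card_mono)
qed

lemma ancestor_count_le_1:
  assumes T: "leaf_set T"
  shows "ancestor_count T j x \<le> 1"
proof -
  let ?A = "{w \<in> tree_nodes T. prefix w x \<and> clone_size T w = j}"
  have "w = w'" if "w \<in> ?A" "w' \<in> ?A" for w w'
  proof -
    have "prefix w w' \<or> prefix w' w" using that prefix_same_cases[of w x w'] by auto
    then show ?thesis
      using that clone_size_strict_mono[OF T, of w w'] clone_size_strict_mono[OF T, of w' w]
      by (auto simp: strict_prefix_def)
  qed
  then show ?thesis unfolding ancestor_count_def
    by (metis (no_types, lifting) One_nat_def card.empty card.infinite card_le_Suc0_iff_eq zero_le_one)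
qed

lemma sum_ancestor_count:
  assumes T: "leaf_set T"
  shows "(\<Sum>x\<in>T. ancestor_count T j x) = j * clone_count T j"
proof -
  note fin = leaf_setD(1)[OF T] finite_tree_nodes[OF leaf_setD(1)[OF T]]
  have "(\<Sum>x\<in>T. ancestor_count T j x)
      = (\<Sum>x\<in>T. \<Sum>w\<in>{w \<in> tree_nodes T. clone_size T w = j}. of_bool (prefix w x))"
  proof (rule sum.cong[OF refl])
    fix x
    have "{w \<in> tree_nodes T. prefix w x \<and> clone_size T w = j}
      = {w \<in> {w \<in> tree_nodes T. clone_size T w = j}. prefix w x}" by auto
    then show "ancestor_count T j x = (\<Sum>w\<in>{w \<in> tree_nodes T. clone_size T w = j}. of_bool (prefix w x))"
      using fin by (simp add: ancestor_count_def of_bool_def sum.If_cases Int_def)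
  qed
  also have "\<dots> = (\<Sum>w\<in>{w \<in> tree_nodes T. clone_size T w = j}. \<Sum>x\<in>T. of_bool (prefix w x))"
    by (rule sum.swap)
  also have "\<dots> = (\<Sum>w\<in>{w \<in> tree_nodes T. clone_size T w = j}. clone_size T w)"
    using fin by (intro sum.cong) (auto simp: clone_size_def of_bool_def sum.If_cases Int_def)
  also have "\<dots> = j * clone_count T j" by (simp add: clone_count_def)
  finally show ?thesis .
qed

lemma clone_count_split:
  assumes T: "leaf_set T" and x: "x \<in> T"
  shows "real (clone_count (split_leaf T x) (Suc j)) =
    real (clone_count T (Suc j)) - real (ancestor_count T (Suc j) x) + real (ancestor_count T j x)
     + (if j = 0 then 2 else 0)"
proof -
  note fin = finite_tree_nodes[OF leaf_setD(1)[OF T]]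
  let ?T = "split_leaf T x"
  let ?A = "{w \<in> tree_nodes T. clone_size T w = Suc j}"
  let ?B = "{w \<in> tree_nodes T. prefix w x \<and> clone_size T w = Suc j}"
  let ?C = "{w \<in> tree_nodes T. prefix w x \<and> clone_size T w = j}"
  let ?N = "if j = 0 then {x @ [False], x @ [True]} else {}"
  have new: "x @ [b] \<notin> tree_nodes T" for b by (rule child_notin_nodes[OF assms])
  have "{w \<in> tree_nodes ?T. clone_size ?T w = Suc j} = (?A - ?B \<union> ?C) \<union> ?N"
    unfolding tree_nodes_split[OF assms]
    using clone_size_split_old[OF assms] clone_size_split_new[OF assms] by (auto simp: of_bool_def split: if_splits)
  then have "clone_count ?T (Suc j) = card ((?A - ?B \<union> ?C) \<union> ?N)" by (simp add: clone_count_def)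
  also have "\<dots> = card (?A - ?B \<union> ?C) + card ?N"
    using fin new by (intro card_Un_disjoint) (auto split: if_splits)
  also have "card (?A - ?B \<union> ?C) = card (?A - ?B) + card ?C"
    using fin by (intro card_Un_disjoint) auto
  also have "card (?A - ?B) = card ?A - card ?B"
    using fin by (intro card_Diff_subset) auto
  also have "card ?N = (if j = 0 then 2 else 0)" by simp
  finally have "clone_count ?T (Suc j) = card ?A - card ?B + card ?C + (if j = 0 then 2 else 0)" .
  moreover have "card ?B \<le> card ?A" using fin by (intro card_mono) auto
  ultimately show ?thesis
    by (auto simp: clone_count_def ancestor_count_def of_nat_diff)
qed

lemma clone_count_0: "finite T \<Longrightarrow> clone_count T 0 = 0"
  using clone_size_pos[of T] unfolding clone_count_def
  by (metis (mono_tags, lifting) Collect_empty_eq card.empty less_irrefl)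

definition nested_pairs :: "cell set \<Rightarrow> (cell \<times> cell) set" where
  "nested_pairs T = {(a, b). a \<in> tree_nodes T \<and> b \<in> tree_nodes T \<and> strict_prefix a b}"

lemma finite_nested_pairs: "finite T \<Longrightarrow> finite (nested_pairs T)"
  by (rule finite_subset[of _ "tree_nodes T \<times> tree_nodes T"]) (auto simp: nested_pairs_def finite_tree_nodes)

lemma card_nested_pairs_split:
  assumes T: "leaf_set T" and x: "x \<in> T"
  shows "card (nested_pairs (split_leaf T x)) \<le> card (nested_pairs T) + 2 * length x"
proof -
  let ?P = "set (prefixes x) - {[]}"
  have "strict_prefix a (x @ [b]) \<longleftrightarrow> prefix a x" for a b
    by (auto simp: strict_prefix_def prefix_snoc_cases)
  moreover have "\<not> strict_prefix (x @ [b]) a" if a: "a \<in> tree_nodes (split_leaf T x)" for a b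
  proof
    assume "strict_prefix (x @ [b]) a"
    obtain y where y: "y \<in> split_leaf T x" "prefix a y" using a by (auto simp: tree_nodes_def)
    have "x @ [b] \<in> split_leaf T x" by (cases b) (auto simp: split_leaf_def)
    then have "x @ [b] = y"
      using leaf_setD(3)[OF leaf_set_split(1)[OF assms], of "x @ [b]" y] y \<open>strict_prefix (x @ [b]) a\<close>
      by (auto simp: strict_prefix_def dest: prefix_order.trans)
    then show False using y \<open>strict_prefix (x @ [b]) a\<close> by (meson prefix_order.leD)
  qed
  ultimately have "nested_pairs (split_leaf T x) \<subseteq> nested_pairs T \<union> ?P \<times> {x @ [False], x @ [True]}"
    unfolding nested_pairs_def by (auto simp: tree_nodes_split[OF assms]) (auto simp: tree_nodes_def)
  then have "card (nested_pairs (split_leaf T x)) \<le> card (nested_pairs T \<union> ?P \<times> {x @ [False], x @ [True]})"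
    using finite_nested_pairs[OF leaf_setD(1)[OF T]] by (intro card_mono) auto
  also have "\<dots> \<le> card (nested_pairs T) + card (?P \<times> {x @ [False], x @ [True]})"
    by (rule card_Un_le)
  also have "card (?P \<times> {x @ [False], x @ [True]}) = 2 * card ?P" by (simp add: card_cartesian_product)
  also have "card ?P = length x"
    by (simp add: card_Diff_singleton distinct_card[OF distinct_prefixes])
  finally show ?thesis by simp
qed

lemma tree_nodes_root: "tree_nodes {[]} = {}"
  by (auto simp: tree_nodes_def)

lemma integrable_yule_tree: "integrable (yule_tree n) (g :: cell set \<Rightarrow> real)"
  by (rule integrable_measure_pmf_finite[OF finite_set_yule_tree])

lemma yule_expectation_Suc:
  fixes g :: "cell set \<Rightarrow> real"
  shows "measure_pmf.expectation (yule_tree (Suc n)) g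
    = measure_pmf.expectation (yule_tree n) (\<lambda>T. (\<Sum>x\<in>T. g (split_leaf T x)) / real (Suc n))"
proof -
  have T: "finite T" "T \<noteq> {}" "card T = Suc n" if "T \<in> set_pmf (yule_tree n)" for T
    using yule_tree_leaf_set[OF that] leaf_setD(1,2)[of T] by auto
  have "measure_pmf.expectation (yule_tree (Suc n)) g
    = (\<Sum>T\<in>set_pmf (yule_tree n). pmf (yule_tree n) T *\<^sub>R
        measure_pmf.expectation (map_pmf (split_leaf T) (pmf_of_set T)) g)"
    unfolding yule_tree.simps
    by (rule pmf_expectation_bind) (auto simp: finite_set_yule_tree set_pmf_of_set T)
  also have "\<dots> = (\<Sum>T\<in>set_pmf (yule_tree n). pmf (yule_tree n) T *\<^sub>R
        ((\<Sum>x\<in>T. g (split_leaf T x)) / real (Suc n)))"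
    by (intro sum.cong refl) (simp add: integral_map_pmf integral_pmf_of_set T)
  also have "\<dots> = measure_pmf.expectation (yule_tree n) (\<lambda>T. (\<Sum>x\<in>T. g (split_leaf T x)) / real (Suc n))"
    by (rule integral_measure_pmf[symmetric]) (auto simp: finite_set_yule_tree)
  finally show ?thesis .
qed

lemma yule_expectation_mono:
  fixes f g :: "cell set \<Rightarrow> real"
  assumes "\<And>T. leaf_set T \<Longrightarrow> card T = Suc n \<Longrightarrow> f T \<le> g T"
  shows "measure_pmf.expectation (yule_tree n) f \<le> measure_pmf.expectation (yule_tree n) g"
  by (rule integral_mono_AE) (use assms yule_tree_leaf_set in \<open>auto simp: integrable_yule_tree AE_measure_pmf_iff\<close>)

definition ld_weight :: "nat \<Rightarrow> real" where
  "ld_weight j = (if j = 0 then 0 else 1 / (real j * (real j + 1)))"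

definition clone_deviation :: "nat \<Rightarrow> cell set \<Rightarrow> real" where
  "clone_deviation j T = real (clone_count T j) - 2 * real (card T) * ld_weight j"

lemma ld_weight_rec: "real j * ld_weight j - (real j + 2) * ld_weight (Suc j) = (if j = 0 then -1 else 0)"
proof (cases j)
  case (Suc i)
  have "real j * ld_weight j = 1 / (real j + 1)" "(real j + 2) * ld_weight (Suc j) = 1 / (real j + 1)"
    using Suc by (auto simp: ld_weight_def divide_simps)
  then show ?thesis using Suc by simp
qed (simp add: ld_weight_def)

lemma ld_weight_bounds: "0 \<le> ld_weight j" "ld_weight j \<le> 1 / 2"
proof -
  show "0 \<le> ld_weight j" by (simp add: ld_weight_def)
  show "ld_weight j \<le> 1 / 2"
  proof (cases j)
    case (Suc i)
    have "2 \<le> (real i + 1) * (real i + 2)" by (simp add: algebra_simps)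
    then show ?thesis using Suc by (simp add: ld_weight_def divide_simps algebra_simps)
  qed (simp add: ld_weight_def)
qed

text \<open>The clone counts have linear drift: splitting a uniform leaf moves a clone of size
  \<^term>\<open>j\<close> to size \<^term>\<open>Suc j\<close> with probability proportional to \<^term>\<open>j\<close>, and
  \<^const>\<open>ld_weight\<close> is the stationary profile.\<close>
lemma clone_deviation_step:
  assumes T: "leaf_set T"
  shows "(\<Sum>x\<in>T. (clone_deviation (Suc j) (split_leaf T x))\<^sup>2)
    \<le> real (card T) * (clone_deviation (Suc j) T)\<^sup>2 + real j * (clone_deviation j T)\<^sup>2 + 9 * real (card T)"
proof -
  define e d m p where "e = clone_deviation (Suc j) T" and "d = clone_deviation j T"
    and "m = real (card T)" and "p = ld_weight (Suc j)"
  define c :: real where "c = (if j = 0 then 2 else 0)"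
  define \<Delta> where "\<Delta> x = - real (ancestor_count T (Suc j) x) + real (ancestor_count T j x) + c - 2 * p" for x
  have dev: "clone_deviation (Suc j) (split_leaf T x) = e + \<Delta> x" if "x \<in> T" for x
    using clone_count_split[OF T that, of j] leaf_set_split(2)[OF T that]
    by (simp add: clone_deviation_def e_def \<Delta>_def c_def p_def algebra_simps)
  have "(\<Delta> x)\<^sup>2 \<le> 9" if "x \<in> T" for x
  proof -
    have "ancestor_count T (Suc j) x \<le> 1" "ancestor_count T j x \<le> 1"
      using ancestor_count_le_1[OF T] by auto
    moreover have "0 \<le> p" "p \<le> 1 / 2" "0 \<le> c" "c \<le> 2" using ld_weight_bounds by (auto simp: p_def c_def)
    ultimately have "\<bar>\<Delta> x\<bar> \<le> 3" unfolding \<Delta>_def by simp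
    then have "\<bar>\<Delta> x\<bar>\<^sup>2 \<le> 3\<^sup>2" by (intro power_mono) auto
    then show ?thesis by simp
  qed
  then have sq: "(\<Sum>x\<in>T. (\<Delta> x)\<^sup>2) \<le> 9 * m" using sum_bounded_above[of T "\<lambda>x. (\<Delta> x)\<^sup>2" 9] by (simp add: m_def)
  have "(\<Sum>x\<in>T. \<Delta> x) = - (\<Sum>x\<in>T. real (ancestor_count T (Suc j) x)) + (\<Sum>x\<in>T. real (ancestor_count T j x)) + m * (c - 2 * p)"
    by (simp add: \<Delta>_def sum.distrib sum_subtractf sum_negf m_def algebra_simps)
  also have "\<dots> = - (real (Suc j) * real (clone_count T (Suc j))) + real j * real (clone_count T j) + m * (c - 2 * p)"
    unfolding of_nat_sum[symmetric] sum_ancestor_count[OF T] of_nat_mult ..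
  also have "\<dots> = - ((real j + 1) * e) + real j * d + m * (c + 2 * (real j * ld_weight j - (real j + 2) * p))"
    by (simp add: e_def d_def clone_deviation_def m_def p_def algebra_simps)
  also have "c + 2 * (real j * ld_weight j - (real j + 2) * p) = 0"
    unfolding p_def ld_weight_rec by (simp add: c_def)
  finally have drift: "(\<Sum>x\<in>T. \<Delta> x) = real j * d - (real j + 1) * e" by simp
  have "(\<Sum>x\<in>T. (clone_deviation (Suc j) (split_leaf T x))\<^sup>2) = (\<Sum>x\<in>T. e\<^sup>2 + 2 * e * \<Delta> x + (\<Delta> x)\<^sup>2)"
    using dev by (intro sum.cong) (auto simp: power2_eq_square algebra_simps)
  also have "\<dots> = m * e\<^sup>2 + 2 * e * (\<Sum>x\<in>T. \<Delta> x) + (\<Sum>x\<in>T. (\<Delta> x)\<^sup>2)"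
    by (simp add: sum.distrib sum_distrib_left m_def)
  also have "\<dots> = m * e\<^sup>2 + real j * (2 * e * d) - 2 * (real j + 1) * e\<^sup>2 + (\<Sum>x\<in>T. (\<Delta> x)\<^sup>2)"
    unfolding drift by (simp add: power2_eq_square algebra_simps)
  also have "\<dots> \<le> m * e\<^sup>2 + real j * (e\<^sup>2 + d\<^sup>2) - 2 * (real j + 1) * e\<^sup>2 + 9 * m"
    using sq mult_left_mono[OF sum_squares_bound[of e d], of "real j"] by simp
  also have "\<dots> \<le> m * e\<^sup>2 + real j * d\<^sup>2 + 9 * m"
    by (simp add: algebra_simps)
  finally show ?thesis by (simp add: e_def d_def m_def)
qed

fun deviation_const :: "nat \<Rightarrow> real" where
  "deviation_const 0 = 0"
| "deviation_const (Suc j) = real j * deviation_const j + 9"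

lemma deviation_const_nonneg: "0 \<le> deviation_const j"
  by (induction j) auto

lemma clone_deviation_second_moment:
  "measure_pmf.expectation (yule_tree n) (\<lambda>T. (clone_deviation j T)\<^sup>2) \<le> deviation_const j * real (Suc n)"
proof (induction j arbitrary: n)
  case 0
  have "measure_pmf.expectation (yule_tree n) (\<lambda>T. (clone_deviation 0 T)\<^sup>2) \<le> measure_pmf.expectation (yule_tree n) (\<lambda>T. 0)"
    by (rule yule_expectation_mono) (simp add: clone_deviation_def ld_weight_def clone_count_0 leaf_setD(1))
  then show ?case by simp
next
  case (Suc j)
  note IHj = this
  show ?case
  proof (induction n)
    case 0
    have "(2 * ld_weight (Suc j))\<^sup>2 \<le> 1\<^sup>2"
      using ld_weight_bounds[of "Suc j"] by (intro power_mono) auto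
    also have "(1::real)\<^sup>2 \<le> deviation_const (Suc j)" using deviation_const_nonneg[of j] by simp
    finally show ?case
      by (simp add: clone_deviation_def clone_count_def tree_nodes_root)
  next
    case (Suc n)
    have "measure_pmf.expectation (yule_tree (Suc n)) (\<lambda>T. (clone_deviation (Suc j) T)\<^sup>2)
      \<le> measure_pmf.expectation (yule_tree n) (\<lambda>T. (clone_deviation (Suc j) T)\<^sup>2 +
          real j / real (Suc n) * (clone_deviation j T)\<^sup>2 + 9)"
      unfolding yule_expectation_Suc
    proof (rule yule_expectation_mono)
      fix T assume T: "leaf_set T" "card T = Suc n"
      show "(\<Sum>x\<in>T. (clone_deviation (Suc j) (split_leaf T x))\<^sup>2) / real (Suc n)
        \<le> (clone_deviation (Suc j) T)\<^sup>2 + real j / real (Suc n) * (clone_deviation j T)\<^sup>2 + 9"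
        using clone_deviation_step[OF T(1), of j] T(2) by (simp add: field_simps del: of_nat_Suc)
    qed
    also have "\<dots> = measure_pmf.expectation (yule_tree n) (\<lambda>T. (clone_deviation (Suc j) T)\<^sup>2)
       + real j / real (Suc n) * measure_pmf.expectation (yule_tree n) (\<lambda>T. (clone_deviation j T)\<^sup>2) + 9"
      by (simp add: integrable_yule_tree)
    also have "\<dots> \<le> deviation_const (Suc j) * real (Suc n)
       + real j / real (Suc n) * (deviation_const j * real (Suc n)) + 9"
      using Suc.IH IHj by (intro add_mono mult_left_mono) auto
    also have "\<dots> = deviation_const (Suc j) * real (Suc (Suc n))"
      by (simp add: field_simps)
    finally show ?case .
  qed
qed

lemma clone_deviation_first_moment:
  "measure_pmf.expectation (yule_tree n) (\<lambda>T. \<bar>clone_deviation j T\<bar>)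
    \<le> (1 + deviation_const j) * sqrt (real (Suc n))"
proof -
  define a where "a = sqrt (real (Suc n))"
  have a: "a > 0" "a * a = real (Suc n)" by (auto simp: a_def)
  have "measure_pmf.expectation (yule_tree n) (\<lambda>T. \<bar>clone_deviation j T\<bar>)
     \<le> measure_pmf.expectation (yule_tree n) (\<lambda>T. a + (clone_deviation j T)\<^sup>2 / a)"
  proof (rule yule_expectation_mono)
    fix T
    have "a * \<bar>clone_deviation j T\<bar> \<le> a * a + (clone_deviation j T)\<^sup>2"
    proof -
      have "0 \<le> a * \<bar>clone_deviation j T\<bar>" using a(1) by simp
      then show ?thesis
        using sum_squares_bound[of a "\<bar>clone_deviation j T\<bar>"] by (simp add: power2_eq_square)
    qed
    then show "\<bar>clone_deviation j T\<bar> \<le> a + (clone_deviation j T)\<^sup>2 / a"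
      using a(1) by (simp add: field_simps)
  qed
  also have "\<dots> = a + measure_pmf.expectation (yule_tree n) (\<lambda>T. (clone_deviation j T)\<^sup>2) / a"
    by (simp add: integrable_yule_tree)
  also have "\<dots> \<le> a + deviation_const j * (a * a) / a"
    using clone_deviation_second_moment[of n j] a by (intro add_left_mono divide_right_mono) auto
  also have "\<dots> = (1 + deviation_const j) * a" using a(1) by (simp add: algebra_simps)
  finally show ?thesis by (simp add: a_def)
qed

lemma sum_length_split:
  assumes T: "leaf_set T" and x: "x \<in> T"
  shows "(\<Sum>y\<in>split_leaf T x. length y) = (\<Sum>y\<in>T. length y) + length x + 2"
  using leaf_setD(1)[OF T] leaf_set_child[OF assms] sum.remove[of T x length] x
  by (simp add: split_leaf_def)

lemma expected_path_length:
  "measure_pmf.expectation (yule_tree n) (\<lambda>T. real (\<Sum>y\<in>T. length y)) \<le> 4 * real (Suc n) * sqrt (real (Suc n))"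
proof (induction n)
  case (Suc n)
  have "measure_pmf.expectation (yule_tree (Suc n)) (\<lambda>T. real (\<Sum>y\<in>T. length y))
    \<le> measure_pmf.expectation (yule_tree n) (\<lambda>T. (1 + 1 / real (Suc n)) * real (\<Sum>y\<in>T. length y) + 2)"
    unfolding yule_expectation_Suc
  proof (rule yule_expectation_mono)
    fix T assume T: "leaf_set T" "card T = Suc n"
    have "(\<Sum>x\<in>T. real (\<Sum>y\<in>split_leaf T x. length y)) = (\<Sum>x\<in>T. real (\<Sum>y\<in>T. length y) + real (length x) + 2)"
      using sum_length_split[OF T(1)] by (intro sum.cong) auto
    also have "\<dots> = (real (Suc n) + 1) * real (\<Sum>y\<in>T. length y) + 2 * real (Suc n)"
      using T(2) by (simp add: sum.distrib algebra_simps)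
    finally show "(\<Sum>x\<in>T. real (\<Sum>y\<in>split_leaf T x. length y)) / real (Suc n)
      \<le> (1 + 1 / real (Suc n)) * real (\<Sum>y\<in>T. length y) + 2"
      by (simp add: field_simps del: of_nat_Suc of_nat_sum)
  qed
  also have "\<dots> = (1 + 1 / real (Suc n)) * measure_pmf.expectation (yule_tree n) (\<lambda>T. real (\<Sum>y\<in>T. length y)) + 2"
    by (simp add: integrable_yule_tree del: of_nat_sum of_nat_Suc)
  also have "\<dots> \<le> (1 + 1 / real (Suc n)) * (4 * real (Suc n) * sqrt (real (Suc n))) + 2"
    using Suc.IH by (intro add_right_mono mult_left_mono) auto
  also have "\<dots> = 4 * real (Suc (Suc n)) * sqrt (real (Suc n)) + 2"
    by (simp add: field_simps)
  also have "\<dots> \<le> 4 * real (Suc (Suc n)) * sqrt (real (Suc (Suc n)))"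
  proof -
    define a b where "a = sqrt (real (Suc n))" and "b = sqrt (real (Suc (Suc n)))"
    have ab: "0 \<le> a" "a \<le> b" "b * b = real (Suc (Suc n))" "b * b - a * a = 1" "0 < b" by (auto simp: a_def b_def)
    have "1 = (b - a) * (b + a)" using ab(4) by (simp add: algebra_simps)
    also have "\<dots> \<le> (b - a) * (2 * b)" using ab by (intro mult_left_mono) auto
    finally have "1 \<le> (b - a) * (2 * b)" .
    also have "\<dots> \<le> (b - a) * (2 * b * b)"
    proof (intro mult_left_mono)
      have "2 * b * 1 \<le> 2 * b * b" using ab(5) by (intro mult_left_mono) (auto simp: b_def)
      then show "2 * b \<le> 2 * b * b" by simp
    qed (use ab in auto)
    finally have "2 \<le> 4 * (b * b) * (b - a)" by (simp add: algebra_simps)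
    then have "4 * (b * b) * a + 2 \<le> 4 * (b * b) * b" by (simp add: algebra_simps)
    then show ?thesis by (simp only: ab(3) flip: a_def b_def)
  qed
  finally show ?case .
qed simp

lemma expected_nested_pairs:
  "measure_pmf.expectation (yule_tree n) (\<lambda>T. real (card (nested_pairs T))) \<le> 8 * real n * sqrt (real (Suc n))"
proof (induction n)
  case 0 show ?case by (simp add: nested_pairs_def tree_nodes_root)
next
  case (Suc n)
  have "measure_pmf.expectation (yule_tree (Suc n)) (\<lambda>T. real (card (nested_pairs T)))
    \<le> measure_pmf.expectation (yule_tree n) (\<lambda>T. real (card (nested_pairs T)) + 2 / real (Suc n) * real (\<Sum>y\<in>T. length y))"
    unfolding yule_expectation_Suc
  proof (rule yule_expectation_mono)
    fix T assume T: "leaf_set T" "card T = Suc n"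
    have "(\<Sum>x\<in>T. real (card (nested_pairs (split_leaf T x)))) \<le> (\<Sum>x\<in>T. real (card (nested_pairs T)) + 2 * real (length x))"
    proof (rule sum_mono)
      fix x assume "x \<in> T"
      from card_nested_pairs_split[OF T(1) this]
      show "real (card (nested_pairs (split_leaf T x))) \<le> real (card (nested_pairs T)) + 2 * real (length x)"
        by linarith
    qed
    also have "\<dots> = real (Suc n) * real (card (nested_pairs T)) + 2 * real (\<Sum>y\<in>T. length y)"
      using T(2) by (simp add: sum.distrib sum_distrib_left)
    finally show "(\<Sum>x\<in>T. real (card (nested_pairs (split_leaf T x)))) / real (Suc n)
      \<le> real (card (nested_pairs T)) + 2 / real (Suc n) * real (\<Sum>y\<in>T. length y)"
      by (simp add: field_simps del: of_nat_Suc of_nat_sum)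
  qed
  also have "\<dots> = measure_pmf.expectation (yule_tree n) (\<lambda>T. real (card (nested_pairs T)))
      + 2 / real (Suc n) * measure_pmf.expectation (yule_tree n) (\<lambda>T. real (\<Sum>y\<in>T. length y))"
    by (simp add: integrable_yule_tree del: of_nat_sum of_nat_Suc)
  also have "\<dots> \<le> 8 * real n * sqrt (real (Suc n)) + 2 / real (Suc n) * (4 * real (Suc n) * sqrt (real (Suc n)))"
    using Suc.IH expected_path_length[of n] by (intro add_mono mult_left_mono) auto
  also have "\<dots> = 8 * real (Suc n) * sqrt (real (Suc n))" by (simp add: field_simps)
  also have "\<dots> \<le> 8 * real (Suc n) * sqrt (real (Suc (Suc n)))" by (intro mult_left_mono) auto
  finally show ?case .
qed

section \<open>Mutations on a fixed tree\<close>

lemma prob_space_mutation: "prob_space (mutation_space mu)"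
  unfolding mutation_space_def by (rule prob_space_PiM) (rule prob_space_measure_pmf)

lemma space_mutation [simp]: "space (mutation_space mu) = UNIV"
  by (simp add: mutation_space_def space_PiM)

lemma measurable_mutation_component [measurable]:
  "(\<lambda>Z. Z p) \<in> measurable (mutation_space mu) (count_space UNIV)"
  using measurable_component_singleton[of p UNIV "\<lambda>_. measure_pmf (mut_pmf mu)"]
  by (simp add: mutation_space_def)

lemma borel_measurable_mutation_component [measurable]:
  "(\<lambda>Z. f (Z p) :: 'a :: topological_space) \<in> borel_measurable (mutation_space mu)"
  by (rule measurable_compose[OF measurable_mutation_component]) simp

lemma set_mut_pmf: "set_pmf (mut_pmf mu) \<subseteq> {0, 1, 2, 3}"
  unfolding mut_pmf_def by (auto simp: set_pmf_of_set split: if_splits)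

lemma finite_set_mut_pmf: "finite (set_pmf (mut_pmf mu))"
  using set_mut_pmf by (rule finite_subset) simp

lemma expectation_mut_pmf:
  assumes "0 \<le> mu" "mu \<le> 1"
  shows "measure_pmf.expectation (mut_pmf mu) (\<lambda>z. if z = 0 then a else b) = (1 - mu) * a + mu * (b::real)"
proof -
  have "measure_pmf.expectation (mut_pmf mu) (\<lambda>z. if z = 0 then a else b) =
    (\<Sum>x\<in>UNIV. pmf (bernoulli_pmf mu) x *\<^sub>R measure_pmf.expectation
      (if x then pmf_of_set {1, 2, 3} else return_pmf 0) (\<lambda>z::nat. if z = 0 then a else b))"
    unfolding mut_pmf_def by (rule pmf_expectation_bind) (auto simp: set_pmf_of_set)
  then show ?thesis using assms by (simp add: UNIV_bool integral_pmf_of_set)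
qed

lemma AE_mutation_range: "AE Z in mutation_space mu. \<forall>p. Z p \<in> {0, 1, 2, 3}"
  unfolding AE_all_countable
proof
  fix p
  show "AE Z in mutation_space mu. Z p \<in> {0, 1, 2, 3}"
    unfolding mutation_space_def
    by (rule AE_PiM_component) (use set_mut_pmf in \<open>auto simp: prob_space_measure_pmf AE_measure_pmf_iff\<close>)
qed

lemma mutation_expectation_prod:
  fixes f :: "cell \<times> nat \<Rightarrow> nat \<Rightarrow> real"
  assumes J: "finite J"
  shows "(\<integral>Z. (\<Prod>p\<in>J. f p (Z p)) \<partial>mutation_space mu) = (\<Prod>p\<in>J. measure_pmf.expectation (mut_pmf mu) (f p))"
proof -
  interpret product_prob_space "\<lambda>_::cell \<times> nat. measure_pmf (mut_pmf mu)" UNIV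
    by unfold_locales
  let ?M = "\<lambda>_::cell \<times> nat. measure_pmf (mut_pmf mu)"
  have m: "(\<lambda>x. \<Prod>p\<in>J. f p (x p)) \<in> borel_measurable (PiM J ?M)"
  proof (rule borel_measurable_prod)
    fix p assume "p \<in> J"
    then have "(\<lambda>x. x p) \<in> measurable (PiM J ?M) (?M p)" by (rule measurable_component_singleton)
    then show "(\<lambda>x. f p (x p)) \<in> borel_measurable (PiM J ?M)"
      by (rule measurable_compose) simp
  qed
  have "(\<Prod>p\<in>J. measure_pmf.expectation (mut_pmf mu) (f p)) = (\<integral>x. (\<Prod>p\<in>J. f p (x p)) \<partial>PiM J ?M)"
    by (rule product_integral_prod[symmetric, OF J])
       (rule integrable_measure_pmf_finite[OF finite_set_mut_pmf])
  also have "\<dots> = (\<integral>x. (\<Prod>p\<in>J. f p (x p)) \<partial>distr (PiM UNIV ?M) (PiM J ?M) (\<lambda>x. restrict x J))"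
    using distr_PiM_restrict_finite[OF J] by simp
  also have "\<dots> = (\<integral>Z. (\<Prod>p\<in>J. f p (restrict Z J p)) \<partial>PiM UNIV ?M)"
    by (rule integral_distr[OF measurable_restrict_subset m]) simp
  also have "\<dots> = (\<integral>Z. (\<Prod>p\<in>J. f p (Z p)) \<partial>mutation_space mu)"
    by (simp add: mutation_space_def)
  finally show ?thesis by simp
qed

lemma mutate_0: "mutate v 0 = v"
  by (cases v) (simp_all add: mutate_def nuc_of_nat_def)

lemma mutate_neq: "k \<in> {1, 2, 3} \<Longrightarrow> mutate v k \<noteq> v"
  by (cases v) (auto simp: mutate_def nuc_of_nat_def)

lemma genome_Nil: "genome u Z [] i = u i"
  by (simp add: genome_def)

lemma genome_snoc: "genome u Z (w @ [b]) i = mutate (genome u Z w i) (Z (w @ [b], i))"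
proof -
  have "fold (\<lambda>j v. mutate v (Z (take (Suc j) (w @ [b]), i))) [0..<length w] (u i)
      = fold (\<lambda>j v. mutate v (Z (take (Suc j) w, i))) [0..<length w] (u i)"
    by (rule fold_cong) auto
  then show ?thesis by (simp add: genome_def)
qed

lemma measurable_genome [measurable]:
  "(\<lambda>Z. genome u Z w i) \<in> measurable (mutation_space mu) (count_space UNIV)"
proof (induction w rule: rev_induct)
  case Nil
  show ?case by (simp add: genome_Nil)
next
  case (snoc b w)
  have "countable (UNIV :: nucleotide set)"
  proof -
    have "(UNIV :: nucleotide set) = {NA, NC, NG, NT}" using nucleotide.exhaust by blast
    then show ?thesis by (metis countable_finite finite.emptyI finite_insert)
  qed
  then show ?case
    unfolding genome_snoc
    by (intro measurable_compose_countable'[OF _ snoc, where f="\<lambda>v Z. mutate v (Z (w @ [b], i))"])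
       (auto intro!: measurable_compose[OF measurable_mutation_component])
qed

text \<open>With two mutations on one line of descent the second could revert the first.\<close>
lemma genome_neq_iff:
  assumes "\<forall>p. Z p \<in> {0, 1, 2, 3}"
    and "\<And>p q. p \<noteq> [] \<Longrightarrow> strict_prefix p q \<Longrightarrow> prefix q w \<Longrightarrow> Z (p, i) = 0 \<or> Z (q, i) = 0"
  shows "genome u Z w i \<noteq> u i \<longleftrightarrow> (\<exists>p. p \<noteq> [] \<and> prefix p w \<and> Z (p, i) \<noteq> 0)"
  using assms(2)
proof (induction w rule: rev_induct)
  case Nil then show ?case by (auto simp: genome_Nil)
next
  case (snoc b w)
  have IH: "genome u Z w i \<noteq> u i \<longleftrightarrow> (\<exists>p. p \<noteq> [] \<and> prefix p w \<and> Z (p, i) \<noteq> 0)"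
    using snoc.prems by (intro snoc.IH) (auto simp: prefix_snoc_cases)
  show ?case
  proof (cases "Z (w @ [b], i) = 0")
    case True
    then show ?thesis using IH by (auto simp: genome_snoc mutate_0 prefix_snoc_cases)
  next
    case False
    have zero: "Z (p, i) = 0" if "p \<noteq> []" "prefix p w" for p
    proof -
      have "p \<noteq> w @ [b]" using prefix_length_le[OF that(2)] by auto
      then show ?thesis
        using snoc.prems[of p "w @ [b]"] that False by (simp add: strict_prefix_def prefix_snoc_cases)
    qed
    have "\<not> (\<exists>p. p \<noteq> [] \<and> prefix p w \<and> Z (p, i) \<noteq> 0)"
    proof
      assume "\<exists>p. p \<noteq> [] \<and> prefix p w \<and> Z (p, i) \<noteq> 0"
      then obtain p where "p \<noteq> []" "prefix p w" "Z (p, i) \<noteq> 0" by blast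
      then show False using zero[of p] by simp
    qed
    then have "genome u Z w i = u i" unfolding IH[symmetric] by simp
    moreover have "Z (w @ [b], i) \<in> {1, 2, 3}" using spec[OF assms(1), of "(w @ [b], i)"] False by simp
    ultimately have "genome u Z (w @ [b]) i \<noteq> u i" using mutate_neq by (simp add: genome_snoc)
    moreover have "\<exists>p. p \<noteq> [] \<and> prefix p (w @ [b]) \<and> Z (p, i) \<noteq> 0"
      using False by (intro exI[of _ "w @ [b]"]) simp
    ultimately show ?thesis by simp
  qed
qed

definition mutants :: "(nat \<Rightarrow> nucleotide) \<Rightarrow> cell set \<Rightarrow> (cell \<times> nat \<Rightarrow> nat) \<Rightarrow> nat \<Rightarrow> nat" where
  "mutants u T Z i = card {w \<in> T. genome u Z w i \<noteq> u i}"

definition clone_sum :: "cell set \<Rightarrow> (cell \<times> nat \<Rightarrow> nat) \<Rightarrow> nat \<Rightarrow> nat" where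
  "clone_sum T Z i = (\<Sum>w\<in>tree_nodes T. if Z (w, i) = 0 then 0 else clone_size T w)"

lemma mutants_eq_clone_sum:
  assumes fin: "finite T" and Z: "\<forall>p. Z p \<in> {0, 1, 2, 3}"
    and nest: "\<forall>(a, b)\<in>nested_pairs T. Z (a, i) = 0 \<or> Z (b, i) = 0"
  shows "mutants u T Z i = clone_sum T Z i"
proof -
  let ?M = "{p \<in> tree_nodes T. Z (p, i) \<noteq> 0}"
  have iff: "genome u Z x i \<noteq> u i \<longleftrightarrow> (\<exists>p. p \<noteq> [] \<and> prefix p x \<and> Z (p, i) \<noteq> 0)" if x: "x \<in> T" for x
  proof (rule genome_neq_iff[OF Z])
    fix p q assume pq: "p \<noteq> []" "strict_prefix p q" "prefix q x"
    have "prefix p x" by (rule prefix_order.trans[of p q x]) (use pq in \<open>auto simp: strict_prefix_def\<close>)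
    moreover have "q \<noteq> []" using pq by auto
    ultimately have "(p, q) \<in> nested_pairs T"
      using pq x unfolding nested_pairs_def tree_nodes_def by blast
    then show "Z (p, i) = 0 \<or> Z (q, i) = 0" using bspec[OF nest, of "(p, q)"] by simp
  qed
  have "{x \<in> T. genome u Z x i \<noteq> u i} = {x \<in> T. \<exists>p. p \<noteq> [] \<and> prefix p x \<and> Z (p, i) \<noteq> 0}"
    using iff by (intro Collect_cong conj_cong refl)
  also have "\<dots> = (\<Union>p\<in>?M. {x \<in> T. prefix p x})"
    by (auto simp: tree_nodes_def)
  finally have "{x \<in> T. genome u Z x i \<noteq> u i} = (\<Union>p\<in>?M. {x \<in> T. prefix p x})" .
  then have "mutants u T Z i = card (\<Union>p\<in>?M. {x \<in> T. prefix p x})" by (simp add: mutants_def)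
  also have "\<dots> = (\<Sum>p\<in>?M. card {x \<in> T. prefix p x})"
  proof (rule card_UN_disjoint)
    show "finite ?M" using finite_tree_nodes[OF fin] by simp
    show "\<forall>p\<in>?M. finite {x \<in> T. prefix p x}" using fin by simp
    show "\<forall>p\<in>?M. \<forall>q\<in>?M. p \<noteq> q \<longrightarrow> {x \<in> T. prefix p x} \<inter> {x \<in> T. prefix q x} = {}"
    proof (intro ballI impI, rule ccontr)
      fix p q assume pq: "p \<in> ?M" "q \<in> ?M" "p \<noteq> q" "{x \<in> T. prefix p x} \<inter> {x \<in> T. prefix q x} \<noteq> {}"
      then have "strict_prefix p q \<or> strict_prefix q p"
        using prefix_same_cases by (auto simp: strict_prefix_def)
      then have "(p, q) \<in> nested_pairs T \<or> (q, p) \<in> nested_pairs T"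
        using pq by (auto simp: nested_pairs_def)
      then show False using bspec[OF nest, of "(p, q)"] bspec[OF nest, of "(q, p)"] pq by auto
    qed
  qed
  also have "\<dots> = clone_sum T Z i"
    using finite_tree_nodes[OF fin] unfolding clone_sum_def clone_size_def
    by (subst sum.inter_filter) (auto intro!: sum.cong)
  finally show ?thesis .
qed

lemma measurable_mutants [measurable]:
  assumes "finite T"
  shows "(\<lambda>Z. f (mutants u T Z i) :: real) \<in> borel_measurable (mutation_space mu)"
proof -
  have "mutants u T Z i = (\<Sum>w\<in>T. if genome u Z w i \<noteq> u i then 1 else 0)" for Z
    using assms by (simp add: mutants_def sum.If_cases Int_def)
  then have "(\<lambda>Z. mutants u T Z i) \<in> measurable (mutation_space mu) (count_space UNIV)"
    by simp
  then show ?thesis by (rule measurable_compose) simp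
qed

lemma measurable_clone_sum [measurable]:
  "(\<lambda>Z. f (clone_sum T Z i) :: real) \<in> borel_measurable (mutation_space mu)"
proof -
  have "(\<lambda>Z. clone_sum T Z i) \<in> measurable (mutation_space mu) (count_space UNIV)"
    unfolding clone_sum_def by measurable
  then show ?thesis by (rule measurable_compose) simp
qed

definition clone_pgf :: "real \<Rightarrow> real \<Rightarrow> cell set \<Rightarrow> real" where
  "clone_pgf mu s T = (\<Prod>w\<in>tree_nodes T. 1 - mu + mu * s ^ clone_size T w)"

lemma power_clone_sum:
  fixes s :: real
  assumes "finite T"
  shows "s ^ clone_sum T Z i = (\<Prod>w\<in>tree_nodes T. if Z (w, i) = 0 then 1 else s ^ clone_size T w)"
  unfolding clone_sum_def power_sum using assms by (intro prod.cong) auto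

lemma expectation_clone_sums:
  fixes mu s :: real
  assumes mu: "0 \<le> mu" "mu \<le> 1" and T: "finite T" and I: "finite I"
  shows "(\<integral>Z. (\<Prod>i\<in>I. s ^ clone_sum T Z i) \<partial>mutation_space mu) = clone_pgf mu s T ^ card I"
proof -
  have "(\<integral>Z. (\<Prod>i\<in>I. s ^ clone_sum T Z i) \<partial>mutation_space mu)
    = (\<integral>Z. (\<Prod>p\<in>tree_nodes T \<times> I. (if Z p = 0 then 1 else s ^ clone_size T (fst p))) \<partial>mutation_space mu)"
    unfolding power_clone_sum[OF T]
    by (subst prod.swap, subst prod.cartesian_product) (simp add: split_beta')
  also have "\<dots> = (\<Prod>p\<in>tree_nodes T \<times> I. measure_pmf.expectation (mut_pmf mu)
      (\<lambda>z. if z = 0 then 1 else s ^ clone_size T (fst p)))"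
    using finite_tree_nodes[OF T] I by (intro mutation_expectation_prod) simp
  also have "\<dots> = (\<Prod>p\<in>tree_nodes T \<times> I. 1 - mu + mu * s ^ clone_size T (fst p))"
    by (simp add: expectation_mut_pmf[OF mu])
  also have "\<dots> = (\<Prod>w\<in>tree_nodes T. \<Prod>i\<in>I. 1 - mu + mu * s ^ clone_size T w)"
    unfolding prod.cartesian_product by (simp add: split_beta')
  also have "\<dots> = clone_pgf mu s T ^ card I"
    by (simp add: clone_pgf_def prod_power_distrib)
  finally show ?thesis .
qed

lemma clone_pgf_bounds:
  assumes "0 \<le> mu" "mu \<le> 1" "0 \<le> s" "s \<le> 1"
  shows "0 \<le> clone_pgf mu s T" "clone_pgf mu s T \<le> 1"
proof -
  have *: "0 \<le> 1 - mu + mu * s ^ k" "1 - mu + mu * s ^ k \<le> 1" for k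
    using assms mult_left_mono[of "s ^ k" 1 mu] by (auto simp: power_le_one)
  show "0 \<le> clone_pgf mu s T" "clone_pgf mu s T \<le> 1"
    unfolding clone_pgf_def using * by (auto intro!: prod_nonneg prod_le_1)
qed

lemma mutants_clone_sum_expectation:
  fixes mu s :: real
  assumes mu: "0 \<le> mu" "mu \<le> 1" and s: "0 \<le> s" "s \<le> 1" and T: "finite T"
  shows "(\<integral>Z. \<bar>s ^ mutants u T Z i - s ^ clone_sum T Z i\<bar> \<partial>mutation_space mu) \<le> mu\<^sup>2 * card (nested_pairs T)"
proof -
  interpret Q: prob_space "mutation_space mu" by (rule prob_space_mutation)
  note [measurable] = measurable_mutants[OF T]
  let ?h = "\<lambda>Z ab. (if Z (fst ab, i) = 0 then 0 else 1) * (if Z (snd ab, i) = 0 then 0 else (1::real))"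
  have pow: "0 \<le> s ^ k" "s ^ k \<le> 1" for k using s by (auto simp: power_le_one)
  have int: "integrable (mutation_space mu) (\<lambda>Z. ?h Z ab)" for ab
    by (rule Q.integrable_const_bound[where B=1]) auto
  have "(\<integral>Z. \<bar>s ^ mutants u T Z i - s ^ clone_sum T Z i\<bar> \<partial>mutation_space mu)
    \<le> (\<integral>Z. (\<Sum>ab\<in>nested_pairs T. ?h Z ab) \<partial>mutation_space mu)"
  proof (rule integral_mono_AE)
    show "integrable (mutation_space mu) (\<lambda>Z. \<bar>s ^ mutants u T Z i - s ^ clone_sum T Z i\<bar>)"
    proof (rule Q.integrable_const_bound[where B=1])
      show "AE Z in mutation_space mu. norm \<bar>s ^ mutants u T Z i - s ^ clone_sum T Z i\<bar> \<le> 1"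
      proof (rule AE_I2)
        fix Z show "norm \<bar>s ^ mutants u T Z i - s ^ clone_sum T Z i\<bar> \<le> 1"
          using pow[of "mutants u T Z i"] pow[of "clone_sum T Z i"] by (simp add: abs_le_iff)
      qed
    qed measurable
    show "integrable (mutation_space mu) (\<lambda>Z. \<Sum>ab\<in>nested_pairs T. ?h Z ab)" using int by simp
    show "AE Z in mutation_space mu. \<bar>s ^ mutants u T Z i - s ^ clone_sum T Z i\<bar> \<le> (\<Sum>ab\<in>nested_pairs T. ?h Z ab)"
      using AE_mutation_range
    proof eventually_elim
      fix Z :: "cell \<times> nat \<Rightarrow> nat" assume Z: "\<forall>p. Z p \<in> {0, 1, 2, 3}"
      show "\<bar>s ^ mutants u T Z i - s ^ clone_sum T Z i\<bar> \<le> (\<Sum>ab\<in>nested_pairs T. ?h Z ab)"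
      proof (cases "\<forall>(a, b)\<in>nested_pairs T. Z (a, i) = 0 \<or> Z (b, i) = 0")
        case True
        then have "mutants u T Z i = clone_sum T Z i" by (rule mutants_eq_clone_sum[OF T Z])
        then show ?thesis by (simp add: sum_nonneg)
      next
        case False
        then obtain ab where ab: "ab \<in> nested_pairs T" "Z (fst ab, i) \<noteq> 0" "Z (snd ab, i) \<noteq> 0"
          by fastforce
        have "\<bar>s ^ mutants u T Z i - s ^ clone_sum T Z i\<bar> \<le> 1"
          using pow[of "mutants u T Z i"] pow[of "clone_sum T Z i"] by linarith
        also have "1 \<le> (\<Sum>ab\<in>nested_pairs T. ?h Z ab)"
          using member_le_sum[OF ab(1), of "?h Z"] ab finite_nested_pairs[OF T] by simp
        finally show ?thesis .
      qed
    qed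
  qed
  also have "\<dots> = (\<Sum>ab\<in>nested_pairs T. (\<integral>Z. ?h Z ab \<partial>mutation_space mu))"
    using int by (rule Bochner_Integration.integral_sum)
  also have "\<dots> = (\<Sum>ab\<in>nested_pairs T. mu\<^sup>2)"
  proof (rule sum.cong[OF refl])
    fix ab assume "ab \<in> nested_pairs T"
    then have ne: "(fst ab, i) \<noteq> (snd ab, i)" by (auto simp: nested_pairs_def strict_prefix_def)
    have "(\<integral>Z. ?h Z ab \<partial>mutation_space mu)
       = (\<integral>Z. (\<Prod>p\<in>{(fst ab, i), (snd ab, i)}. (if Z p = 0 then 0 else 1)) \<partial>mutation_space mu)"
      using ne by simp
    also have "\<dots> = (\<Prod>p\<in>{(fst ab, i), (snd ab, i)}. measure_pmf.expectation (mut_pmf mu) (\<lambda>z. if z = 0 then 0 else 1))"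
      by (rule mutation_expectation_prod) simp
    also have "\<dots> = mu\<^sup>2" using ne by (simp add: expectation_mut_pmf[OF mu] power2_eq_square)
    finally show "(\<integral>Z. ?h Z ab \<partial>mutation_space mu) = mu\<^sup>2" .
  qed
  finally show ?thesis by (simp add: mult.commute)
qed

lemma clone_sum_average_variance:
  fixes mu s :: real
  assumes mu: "0 \<le> mu" "mu \<le> 1" and s: "0 \<le> s" "s \<le> 1" and T: "finite T" and S: "finite S" "S \<noteq> {}"
  shows "(\<integral>Z. ((\<Sum>i\<in>S. s ^ clone_sum T Z i) / card S - clone_pgf mu s T)\<^sup>2 \<partial>mutation_space mu) \<le> 1 / card S"
proof -
  interpret Q: prob_space "mutation_space mu" by (rule prob_space_mutation)
  define m where "m = clone_pgf mu s T"
  define Y where "Y i Z = s ^ clone_sum T Z i" for i Z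
  have [measurable]: "Y i \<in> borel_measurable (mutation_space mu)" for i
    unfolding Y_def by measurable
  have Y: "0 \<le> Y i Z" "Y i Z \<le> 1" for i Z using s by (auto simp: Y_def power_le_one)
  have m: "0 \<le> m" "m \<le> 1" using clone_pgf_bounds[OF mu s] by (auto simp: m_def)
  have Ym: "\<bar>Y i Z - m\<bar> \<le> 1" for i Z using Y[of i Z] m by (simp add: abs_le_iff)
  have intY: "integrable (mutation_space mu) (Y i)" for i
    by (rule Q.integrable_const_bound[where B=1]) (use Y in auto)
  have intYY: "integrable (mutation_space mu) (\<lambda>Z. Y i Z * Y j Z)" for i j
    by (rule Q.integrable_const_bound[where B=1]) (use Y in \<open>auto simp: abs_mult intro!: mult_le_one\<close>)
  have int: "integrable (mutation_space mu) (\<lambda>Z. (Y i Z - m) * (Y j Z - m))" for i j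
    by (rule Q.integrable_const_bound[where B=1]) (use Ym in \<open>auto simp: abs_mult intro!: mult_le_one\<close>)
  have EY: "(\<integral>Z. Y i Z \<partial>mutation_space mu) = m" for i
    using expectation_clone_sums[OF mu T, of "{i}" s] by (simp add: Y_def m_def)
  have EYY: "(\<integral>Z. Y i Z * Y j Z \<partial>mutation_space mu) = m * m" if "i \<noteq> j" for i j
    using expectation_clone_sums[OF mu T, of "{i, j}" s] that by (simp add: Y_def m_def power2_eq_square)
  have off: "(\<integral>Z. (Y i Z - m) * (Y j Z - m) \<partial>mutation_space mu) = 0" if "i \<noteq> j" for i j
  proof -
    have "(\<integral>Z. (Y i Z - m) * (Y j Z - m) \<partial>mutation_space mu)
      = (\<integral>Z. Y i Z * Y j Z - m * Y j Z - m * Y i Z + m * m \<partial>mutation_space mu)"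
      by (simp add: algebra_simps)
    also have "\<dots> = 0"
      using intY intYY EY EYY[OF that] by (simp add: Q.prob_space[simplified])
    finally show ?thesis .
  qed
  have diag: "(\<integral>Z. (Y i Z - m) * (Y i Z - m) \<partial>mutation_space mu) \<le> 1" for i
  proof -
    have "(\<integral>Z. (Y i Z - m) * (Y i Z - m) \<partial>mutation_space mu) \<le> (\<integral>Z. 1 \<partial>mutation_space mu)"
    proof (rule integral_mono[OF int])
      show "(Y i Z - m) * (Y i Z - m) \<le> 1" for Z
        using mult_le_one[of "\<bar>Y i Z - m\<bar>" "\<bar>Y i Z - m\<bar>"] Ym[of i Z] by simp
    qed simp
    then show ?thesis by (simp add: Q.prob_space[simplified])
  qed
  let ?c = "real (card S)"
  have c: "?c > 0" using S by (simp add: card_gt_0_iff)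
  have "((\<Sum>i\<in>S. Y i Z) / ?c - m)\<^sup>2 = (\<Sum>i\<in>S. \<Sum>j\<in>S. (Y i Z - m) * (Y j Z - m)) / ?c\<^sup>2" for Z
  proof -
    have "(\<Sum>i\<in>S. Y i Z) / ?c - m = (\<Sum>i\<in>S. Y i Z - m) / ?c"
      using c by (simp add: sum_subtractf field_simps)
    then show ?thesis by (simp add: power_divide power2_eq_square sum_product)
  qed
  then have "(\<integral>Z. ((\<Sum>i\<in>S. Y i Z) / ?c - m)\<^sup>2 \<partial>mutation_space mu)
    = (\<Sum>i\<in>S. \<Sum>j\<in>S. (\<integral>Z. (Y i Z - m) * (Y j Z - m) \<partial>mutation_space mu)) / ?c\<^sup>2"
    using int by simp
  also have "\<dots> \<le> (\<Sum>i\<in>S. \<Sum>j\<in>S. if j = i then 1 else 0) / ?c\<^sup>2"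
    using off diag by (intro divide_right_mono sum_mono) auto
  also have "\<dots> = 1 / ?c" using S c by (simp add: power2_eq_square)
  finally show ?thesis by (simp add: Y_def m_def)
qed

lemma mutant_average_expectation:
  fixes mu s G :: real
  assumes mu: "0 \<le> mu" "mu \<le> 1" and s: "0 \<le> s" "s \<le> 1" and T: "finite T" and S: "finite S" "S \<noteq> {}"
  shows "integrable (mutation_space mu) (\<lambda>Z. \<bar>(\<Sum>i\<in>S. s ^ mutants u T Z i) / card S - G\<bar>)"
    and "(\<integral>Z. \<bar>(\<Sum>i\<in>S. s ^ mutants u T Z i) / card S - G\<bar> \<partial>mutation_space mu)
      \<le> mu\<^sup>2 * card (nested_pairs T) + 2 / sqrt (card S) + \<bar>clone_pgf mu s T - G\<bar>"
proof -
  interpret Q: prob_space "mutation_space mu" by (rule prob_space_mutation)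
  note [measurable] = measurable_mutants[OF T]
  define m where "m = clone_pgf mu s T"
  let ?c = "real (card S)"
  have c: "?c > 0" using S by (simp add: card_gt_0_iff)
  define a where "a = 1 / sqrt ?c"
  have a: "a > 0" "1 / ?c = a * a" using c by (auto simp: a_def)
  have pow: "0 \<le> s ^ k" "s ^ k \<le> 1" for k using s by (auto simp: power_le_one)
  have d1: "\<bar>s ^ k - s ^ l\<bar> \<le> 1" for k l using pow[of k] pow[of l] by linarith
  let ?B = "\<lambda>Z. (\<Sum>i\<in>S. s ^ mutants u T Z i) / ?c" and ?X = "\<lambda>Z. (\<Sum>i\<in>S. s ^ clone_sum T Z i) / ?c"
  have avg: "0 \<le> (\<Sum>i\<in>S. s ^ f i) / ?c" "(\<Sum>i\<in>S. s ^ f i) / ?c \<le> 1" for f :: "nat \<Rightarrow> nat"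
    using pow c sum_bounded_above[of S "\<lambda>i. s ^ f i" 1] by (auto intro!: sum_nonneg divide_nonneg_pos)
  show intB: "integrable (mutation_space mu) (\<lambda>Z. \<bar>?B Z - G\<bar>)"
  proof (rule Q.integrable_const_bound[where B="1 + \<bar>G\<bar>"])
    show "AE Z in mutation_space mu. norm \<bar>?B Z - G\<bar> \<le> 1 + \<bar>G\<bar>"
    proof (rule AE_I2)
      fix Z show "norm \<bar>?B Z - G\<bar> \<le> 1 + \<bar>G\<bar>" using avg[of "mutants u T Z"] by (simp add: abs_le_iff) linarith
    qed
  qed measurable
  have int1: "integrable (mutation_space mu) (\<lambda>Z. \<bar>s ^ mutants u T Z i - s ^ clone_sum T Z i\<bar>)" for i
    by (rule Q.integrable_const_bound[where B=1]) (use d1 in auto)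
  have int2: "integrable (mutation_space mu) (\<lambda>Z. (?X Z - m)\<^sup>2)"
  proof (rule Q.integrable_const_bound[where B="1"])
    show "AE Z in mutation_space mu. norm ((?X Z - m)\<^sup>2) \<le> 1"
    proof (rule AE_I2)
      fix Z
      have "\<bar>?X Z - m\<bar> \<le> 1" using avg[of "clone_sum T Z"] clone_pgf_bounds[OF mu s, of T] by (auto simp: m_def abs_le_iff)
      then show "norm ((?X Z - m)\<^sup>2) \<le> 1" by (simp add: abs_square_le_1)
    qed
  qed measurable
  have "(\<integral>Z. \<bar>?B Z - G\<bar> \<partial>mutation_space mu) \<le>
    (\<integral>Z. (\<Sum>i\<in>S. \<bar>s ^ mutants u T Z i - s ^ clone_sum T Z i\<bar>) / ?c + (a + (?X Z - m)\<^sup>2 / a) + \<bar>m - G\<bar> \<partial>mutation_space mu)"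
  proof (rule integral_mono[OF intB])
    show "integrable (mutation_space mu) (\<lambda>Z. (\<Sum>i\<in>S. \<bar>s ^ mutants u T Z i - s ^ clone_sum T Z i\<bar>) / ?c + (a + (?X Z - m)\<^sup>2 / a) + \<bar>m - G\<bar>)"
      using int1 int2 by simp
    fix Z
    have "\<bar>?B Z - ?X Z\<bar> = \<bar>\<Sum>i\<in>S. s ^ mutants u T Z i - s ^ clone_sum T Z i\<bar> / ?c"
      by (simp add: sum_subtractf flip: diff_divide_distrib)
    also have "\<dots> \<le> (\<Sum>i\<in>S. \<bar>s ^ mutants u T Z i - s ^ clone_sum T Z i\<bar>) / ?c"
      by (intro divide_right_mono sum_abs) simp
    finally have 1: "\<bar>?B Z - ?X Z\<bar> \<le> (\<Sum>i\<in>S. \<bar>s ^ mutants u T Z i - s ^ clone_sum T Z i\<bar>) / ?c" .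
    have "a * \<bar>?X Z - m\<bar> \<le> a * a + (?X Z - m)\<^sup>2"
    proof -
      have "0 \<le> a * \<bar>?X Z - m\<bar>" using a(1) by simp
      then show ?thesis using sum_squares_bound[of a "\<bar>?X Z - m\<bar>"] by (simp add: power2_eq_square)
    qed
    then have 2: "\<bar>?X Z - m\<bar> \<le> a + (?X Z - m)\<^sup>2 / a" using a(1) by (simp add: field_simps)
    show "\<bar>?B Z - G\<bar> \<le> (\<Sum>i\<in>S. \<bar>s ^ mutants u T Z i - s ^ clone_sum T Z i\<bar>) / ?c + (a + (?X Z - m)\<^sup>2 / a) + \<bar>m - G\<bar>"
      using 1 2 by linarith
  qed
  also have "\<dots> = (\<Sum>i\<in>S. (\<integral>Z. \<bar>s ^ mutants u T Z i - s ^ clone_sum T Z i\<bar> \<partial>mutation_space mu)) / ?c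
     + (a + (\<integral>Z. (?X Z - m)\<^sup>2 \<partial>mutation_space mu) / a) + \<bar>m - G\<bar>"
    using int1 int2 by (simp add: Q.prob_space[simplified])
  also have "\<dots> \<le> (\<Sum>i\<in>S. mu\<^sup>2 * card (nested_pairs T)) / ?c + (a + (1 / ?c) / a) + \<bar>m - G\<bar>"
    using a(1) mutants_clone_sum_expectation[OF mu s T] clone_sum_average_variance[OF mu s T S]
    by (intro add_mono divide_right_mono sum_mono order_refl) (auto simp: m_def)
  also have "\<dots> = mu\<^sup>2 * card (nested_pairs T) + 2 * a + \<bar>m - G\<bar>"
    using c a by simp
  finally show "(\<integral>Z. \<bar>?B Z - G\<bar> \<partial>mutation_space mu) \<le> mu\<^sup>2 * card (nested_pairs T) + 2 / sqrt ?c + \<bar>clone_pgf mu s T - G\<bar>"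
    by (simp add: a_def m_def)
qed

section \<open>Probability generating functions and the Luria--Delbrueck law\<close>

lemma integrable_measure_pmf_bounded:
  fixes f :: "nat \<Rightarrow> real"
  assumes "\<And>i. \<bar>f i\<bar> \<le> B"
  shows "integrable (measure_pmf q) f"
  by (rule measure_pmf.integrable_const_bound[where B=B]) (use assms in auto)

lemma pmf_expectation_tail:
  fixes f :: "nat \<Rightarrow> real"
  assumes B: "\<And>i. \<bar>f i\<bar> \<le> B" and C: "\<And>i. n \<le> i \<Longrightarrow> \<bar>f i\<bar> \<le> C"
  shows "\<bar>measure_pmf.expectation q f - (\<Sum>i<n. pmf q i * f i)\<bar> \<le> C * (1 - (\<Sum>i<n. pmf q i))"
proof -
  have head: "measure_pmf.expectation q (\<lambda>i. if i < n then g i else 0) = (\<Sum>i<n. pmf q i * g i)" for g :: "nat \<Rightarrow> real"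
    by (subst integral_measure_pmf_real[of "{..<n}"]) (auto simp: mult.commute split: if_splits)
  have B0: "0 \<le> B" using B[of 0] by linarith
  have C0: "0 \<le> C" using C[of n] by linarith
  have int: "integrable q f" "integrable q (\<lambda>i. if i < n then f i else 0)"
    "integrable q (\<lambda>i. if i < n then 0 else f i)" "integrable q (\<lambda>i. if i < n then 0 else C)"
    "integrable q (\<lambda>i. if i < n then C else 0)"
    by (rule integrable_measure_pmf_bounded[where B="B + C"], use B B0 C0 in \<open>auto intro: add_increasing2 add_increasing\<close>)+
  have "measure_pmf.expectation q f - (\<Sum>i<n. pmf q i * f i)
      = measure_pmf.expectation q (\<lambda>i. f i - (if i < n then f i else 0))"
    using int by (simp add: head)
  also have "(\<lambda>i. f i - (if i < n then f i else 0)) = (\<lambda>i. if i < n then 0 else f i)" by auto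
  also have "\<bar>measure_pmf.expectation q (\<lambda>i. if i < n then 0 else f i)\<bar>
      \<le> measure_pmf.expectation q (\<lambda>i. \<bar>if i < n then 0 else f i\<bar>)"
    using integral_abs_bound by blast
  also have "\<dots> \<le> measure_pmf.expectation q (\<lambda>i. if i < n then 0 else C)"
    using int C by (intro integral_mono integrable_abs) auto
  also have "(\<lambda>i. if i < n then 0 else C) = (\<lambda>i. C - (if i < n then C else 0))" by auto
  also have "measure_pmf.expectation q \<dots> = C - (\<Sum>i<n. pmf q i * C)"
    using int by (simp add: head)
  finally show ?thesis by (simp add: algebra_simps sum_distrib_left)
qed

lemma pgf_tail:
  fixes s :: real
  assumes s: "0 \<le> s" "s \<le> 1"
  shows "\<bar>measure_pmf.expectation q (\<lambda>i. s ^ i) - (\<Sum>i<n. pmf q i * s ^ i)\<bar> \<le> s ^ n"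
proof -
  have "\<bar>measure_pmf.expectation q (\<lambda>i. s ^ i) - (\<Sum>i<n. pmf q i * s ^ i)\<bar> \<le> s ^ n * (1 - (\<Sum>i<n. pmf q i))"
    by (rule pmf_expectation_tail[where B=1]) (use s in \<open>auto simp: power_le_one power_decreasing\<close>)
  also have "\<dots> \<le> s ^ n * 1"
    using s by (intro mult_left_mono) (auto simp: sum_nonneg)
  finally show ?thesis by simp
qed

lemma pgf_close_imp_pmf_close:
  fixes p :: "nat pmf"
  assumes "\<epsilon> > 0"
  shows "\<exists>I \<delta>. finite I \<and> I \<subseteq> {0<..<1::real} \<and> 0 < \<delta> \<and>
    (\<forall>q. (\<forall>s\<in>I. \<bar>measure_pmf.expectation q (\<lambda>i. s ^ i) - measure_pmf.expectation p (\<lambda>i. s ^ i)\<bar> < \<delta>) \<longrightarrow>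
      (\<forall>i<n. \<bar>pmf q i - pmf p i\<bar> < \<epsilon>))"
  using assms
proof (induction n arbitrary: \<epsilon>)
  case 0
  show ?case by (intro exI[of _ "{}"] exI[of _ 1]) auto
next
  case (Suc n)
  define s where "s = min (1 / 2) (\<epsilon> / 4)"
  have s: "0 < s" "s < 1" "s \<le> \<epsilon> / 4" using Suc.prems by (auto simp: s_def)
  define \<eta> where "\<eta> = \<epsilon> * s ^ n / 4"
  have \<eta>: "0 < \<eta>" using s Suc.prems by (simp add: \<eta>_def)
  obtain I \<delta> where I: "finite I" "I \<subseteq> {0<..<1::real}" "0 < \<delta>"
    and close: "\<And>q i. (\<forall>s\<in>I. \<bar>measure_pmf.expectation q (\<lambda>i. s ^ i) - measure_pmf.expectation p (\<lambda>i. s ^ i)\<bar> < \<delta>) \<Longrightarrow>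
      i < n \<Longrightarrow> \<bar>pmf q i - pmf p i\<bar> < min \<epsilon> (\<eta> / (real n + 1))"
    using Suc.IH[of "min \<epsilon> (\<eta> / (real n + 1))"] Suc.prems \<eta> by auto
  have "\<bar>pmf q i - pmf p i\<bar> < \<epsilon>"
    if q: "\<forall>s\<in>insert s I. \<bar>measure_pmf.expectation q (\<lambda>i. s ^ i) - measure_pmf.expectation p (\<lambda>i. s ^ i)\<bar> < min \<delta> \<eta>"
      and i: "i < Suc n" for q i
  proof -
    have qi: "\<bar>pmf q i - pmf p i\<bar> < min \<epsilon> (\<eta> / (real n + 1))" if "i < n" for i
      using q that by (intro close) auto
    show ?thesis
    proof (cases "i < n")
      case True then show ?thesis using qi by simp
    next
      case False
      then have [simp]: "i = n" using i by simp
      define Gq Gp where "Gq = measure_pmf.expectation q (\<lambda>i. s ^ i)" and "Gp = measure_pmf.expectation p (\<lambda>i. s ^ i)"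
      have "\<bar>Gq - (\<Sum>i<Suc n. pmf q i * s ^ i)\<bar> \<le> s ^ Suc n" "\<bar>Gp - (\<Sum>i<Suc n. pmf p i * s ^ i)\<bar> \<le> s ^ Suc n"
        unfolding Gq_def Gp_def using s by (auto intro!: pgf_tail simp del: power_Suc sum.lessThan_Suc)
      moreover have "\<bar>Gq - Gp\<bar> < \<eta>" using q by (simp add: Gq_def Gp_def)
      moreover have "\<bar>(\<Sum>i<n. pmf q i * s ^ i) - (\<Sum>i<n. pmf p i * s ^ i)\<bar> \<le> \<eta>"
      proof -
        have "\<bar>(\<Sum>i<n. pmf q i * s ^ i) - (\<Sum>i<n. pmf p i * s ^ i)\<bar> = \<bar>\<Sum>i<n. (pmf q i - pmf p i) * s ^ i\<bar>"
          by (simp add: sum_subtractf algebra_simps)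
        also have "\<dots> \<le> (\<Sum>i<n. \<eta> / (real n + 1))"
        proof (rule sum_abs[THEN order_trans], rule sum_mono)
          fix i assume "i \<in> {..<n}"
          then have "\<bar>pmf q i - pmf p i\<bar> \<le> \<eta> / (real n + 1)" using qi[of i] by simp
          moreover have "0 \<le> s ^ i" "s ^ i \<le> 1" using s by (auto simp: power_le_one)
          ultimately have "\<bar>pmf q i - pmf p i\<bar> * s ^ i \<le> \<eta> / (real n + 1) * 1"
            using \<eta> by (intro mult_mono) auto
          then show "\<bar>(pmf q i - pmf p i) * s ^ i\<bar> \<le> \<eta> / (real n + 1)"
            using s by (simp add: abs_mult)
        qed
        also have "\<dots> \<le> \<eta>" using \<eta> by (simp add: field_simps)
        finally show ?thesis .
      qed
      ultimately have "\<bar>pmf q n * s ^ n - pmf p n * s ^ n\<bar> < 2 * \<eta> + 2 * s ^ Suc n"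
        by simp
      also have "2 * s ^ Suc n \<le> 2 * \<eta>" using s Suc.prems mult_right_mono[OF s(3), of "s ^ n"] by (simp add: \<eta>_def mult.commute)
      also have "2 * \<eta> + 2 * \<eta> = \<epsilon> * s ^ n" by (simp add: \<eta>_def)
      finally have "\<bar>pmf q n - pmf p n\<bar> * s ^ n < \<epsilon> * s ^ n"
        using s by (simp add: left_diff_distrib[symmetric] abs_mult)
      then show ?thesis using s by simp
    qed
  qed
  then show ?case
    using I s \<eta> by (intro exI[of _ "insert s I"] exI[of _ "min \<delta> \<eta>"]) auto
qed

lemma pgf_close_imp_expectation_close:
  fixes p :: "nat pmf" and f :: "nat \<Rightarrow> real"
  assumes f: "bounded (range f)" and \<epsilon>: "\<epsilon> > 0"
  shows "\<exists>I \<delta>. finite I \<and> I \<subseteq> {0<..<1::real} \<and> 0 < \<delta> \<and>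
    (\<forall>q. (\<forall>s\<in>I. \<bar>measure_pmf.expectation q (\<lambda>i. s ^ i) - measure_pmf.expectation p (\<lambda>i. s ^ i)\<bar> < \<delta>) \<longrightarrow>
      \<bar>measure_pmf.expectation q f - measure_pmf.expectation p f\<bar> < \<epsilon>)"
proof -
  obtain B where B: "0 < B" "\<And>i. \<bar>f i\<bar> \<le> B"
    using f unfolding bounded_pos by auto
  have "(\<lambda>n. (\<Sum>i<n. pmf p i)) \<longlonglongrightarrow> 1"
  proof -
    have "(\<lambda>n. measure p {..<n}) \<longlonglongrightarrow> measure p (\<Union>n. {..<n})"
      by (rule measure_pmf.finite_Lim_measure_incseq) (auto simp: incseq_def)
    moreover have "(\<Union>n::nat. {..<n}) = UNIV" by auto
    ultimately show ?thesis by (simp add: measure_measure_pmf_finite measure_pmf.prob_space[simplified])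
  qed
  moreover have "1 - \<epsilon> / (8 * B) < 1" using \<epsilon> B by simp
  ultimately have "\<forall>\<^sub>F n in sequentially. 1 - \<epsilon> / (8 * B) < (\<Sum>i<n. pmf p i)"
    by (rule order_tendstoD)
  then obtain n where n: "1 - \<epsilon> / (8 * B) < (\<Sum>i<n. pmf p i)"
    by (meson eventually_sequentially order_refl)
  define \<eta> where "\<eta> = \<epsilon> / (8 * B * (real n + 1))"
  have \<eta>: "0 < \<eta>" using \<epsilon> B by (simp add: \<eta>_def)
  obtain I \<delta> where I: "finite I" "I \<subseteq> {0<..<1::real}" "0 < \<delta>"
    and close: "\<And>q i. (\<forall>s\<in>I. \<bar>measure_pmf.expectation q (\<lambda>i. s ^ i) - measure_pmf.expectation p (\<lambda>i. s ^ i)\<bar> < \<delta>) \<Longrightarrow>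
      i < n \<Longrightarrow> \<bar>pmf q i - pmf p i\<bar> < \<eta>"
    using pgf_close_imp_pmf_close[OF \<eta>, of p n] by auto
  have "\<bar>measure_pmf.expectation q f - measure_pmf.expectation p f\<bar> < \<epsilon>"
    if q: "\<forall>s\<in>I. \<bar>measure_pmf.expectation q (\<lambda>i. s ^ i) - measure_pmf.expectation p (\<lambda>i. s ^ i)\<bar> < \<delta>" for q
  proof -
    define D where "D = (\<Sum>i<n. \<bar>pmf q i - pmf p i\<bar>)"
    have "D \<le> (\<Sum>i<n. \<eta>)" unfolding D_def using close[OF q] by (intro sum_mono) (auto intro: less_imp_le)
    also have "\<dots> \<le> \<epsilon> / (8 * B)" using \<epsilon> B by (simp add: \<eta>_def divide_simps mult_left_mono)
    finally have D: "B * D \<le> \<epsilon> / 8" using B by (simp add: field_simps)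
    have "\<bar>(\<Sum>i<n. pmf q i * f i) - (\<Sum>i<n. pmf p i * f i)\<bar> = \<bar>\<Sum>i<n. (pmf q i - pmf p i) * f i\<bar>"
      by (simp add: sum_subtractf algebra_simps)
    also have "\<dots> \<le> (\<Sum>i<n. \<bar>pmf q i - pmf p i\<bar> * B)"
      by (rule sum_abs[THEN order_trans], rule sum_mono) (use B in \<open>auto simp: abs_mult intro!: mult_left_mono\<close>)
    also have "\<dots> = B * D" by (simp add: D_def sum_distrib_left mult.commute)
    finally have 1: "\<bar>(\<Sum>i<n. pmf q i * f i) - (\<Sum>i<n. pmf p i * f i)\<bar> \<le> B * D" .
    have "\<bar>(\<Sum>i<n. pmf q i) - (\<Sum>i<n. pmf p i)\<bar> \<le> D"
      unfolding D_def sum_subtractf[symmetric] by (rule sum_abs)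
    then have "1 - (\<Sum>i<n. pmf q i) \<le> \<epsilon> / (8 * B) + D" using n by linarith
    then have "B * (1 - (\<Sum>i<n. pmf q i)) \<le> B * (\<epsilon> / (8 * B) + D)" using B by (intro mult_left_mono) auto
    also have "\<dots> = \<epsilon> / 8 + B * D" using B by (simp add: field_simps)
    finally have 2: "B * (1 - (\<Sum>i<n. pmf q i)) \<le> \<epsilon> / 8 + B * D" .
    have "B * (1 - (\<Sum>i<n. pmf p i)) \<le> B * (\<epsilon> / (8 * B))" using B n by (intro mult_left_mono) auto
    also have "\<dots> = \<epsilon> / 8" using B by simp
    finally have 3: "B * (1 - (\<Sum>i<n. pmf p i)) \<le> \<epsilon> / 8" .
    have "\<bar>measure_pmf.expectation q f - (\<Sum>i<n. pmf q i * f i)\<bar> \<le> B * (1 - (\<Sum>i<n. pmf q i))"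
      "\<bar>measure_pmf.expectation p f - (\<Sum>i<n. pmf p i * f i)\<bar> \<le> B * (1 - (\<Sum>i<n. pmf p i))"
      by (rule pmf_expectation_tail[OF B(2) B(2)])+
    then show ?thesis using 1 2 3 D \<epsilon> by linarith
  qed
  then show ?thesis using I by blast
qed

lemma ld_weight_sums: "ld_weight sums 1"
proof -
  have "(\<lambda>n. inverse (real (Suc n)) - inverse (real (Suc (Suc n)))) sums (inverse (real (Suc 0)) - 0)"
    by (rule telescope_sums'[OF LIMSEQ_inverse_real_of_nat])
  moreover have "ld_weight (Suc n) = inverse (real (Suc n)) - inverse (real (Suc (Suc n)))" for n
    by (simp add: ld_weight_def divide_simps)
  ultimately have "(\<lambda>n. ld_weight (Suc n)) sums 1" by simp
  then show ?thesis by (subst (asm) sums_Suc_iff) (simp add: ld_weight_def)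
qed

lemma pmf_ld_jump: "pmf ld_jump_pmf j = ld_weight j"
proof -
  have "(\<integral>\<^sup>+j. ennreal (ld_weight j) \<partial>count_space UNIV) = ennreal 1"
    unfolding nn_integral_count_space_nat
    using ld_weight_sums ld_weight_bounds(1) by (intro suminf_ennreal_eq) auto
  then show ?thesis
    unfolding ld_jump_pmf_def ld_weight_def[symmetric]
    by (subst pmf_embed_pmf) (auto simp: ld_weight_bounds(1))
qed

definition ld_jump_pgf :: "real \<Rightarrow> real" where
  "ld_jump_pgf s = measure_pmf.expectation ld_jump_pmf (\<lambda>j. s ^ j)"

lemma ld_jump_pgf_bounds:
  assumes "0 \<le> s" "s \<le> 1"
  shows "0 \<le> ld_jump_pgf s" "ld_jump_pgf s \<le> 1"
proof -
  show "0 \<le> ld_jump_pgf s" unfolding ld_jump_pgf_def using assms by (intro Bochner_Integration.integral_nonneg) auto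
  have "ld_jump_pgf s \<le> measure_pmf.expectation ld_jump_pmf (\<lambda>_. 1)"
    unfolding ld_jump_pgf_def using assms
    by (intro integral_mono integrable_measure_pmf_bounded[where B=1]) (auto simp: power_le_one)
  then show "ld_jump_pgf s \<le> 1" by simp
qed

lemma nn_integral_pgf:
  assumes "0 \<le> s" "s \<le> 1"
  shows "(\<integral>\<^sup>+j. ennreal (s ^ j) \<partial>measure_pmf q) = ennreal (measure_pmf.expectation q (\<lambda>j. s ^ j))"
  using assms by (intro nn_integral_eq_integral integrable_measure_pmf_bounded[where B=1]) (auto simp: power_le_one)

lemma nn_integral_ld_sum:
  assumes s: "0 \<le> s" "s \<le> 1"
  shows "(\<integral>\<^sup>+j. ennreal (s ^ j) \<partial>measure_pmf (ld_sum k)) = ennreal (ld_jump_pgf s ^ k)"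
proof (induction k)
  case (Suc k)
  have "(\<integral>\<^sup>+j. ennreal (s ^ j) \<partial>measure_pmf (ld_sum (Suc k)))
    = (\<integral>\<^sup>+i. ennreal (s ^ i) * (\<integral>\<^sup>+j. ennreal (s ^ j) \<partial>measure_pmf ld_jump_pmf) \<partial>measure_pmf (ld_sum k))"
    using s by (simp add: power_add ennreal_mult nn_integral_cmult)
  also have "\<dots> = ennreal (ld_jump_pgf s ^ k) * ennreal (ld_jump_pgf s)"
    using Suc by (simp add: nn_integral_multc nn_integral_pgf[OF s] ld_jump_pgf_def)
  also have "\<dots> = ennreal (ld_jump_pgf s ^ Suc k)"
    using ld_jump_pgf_bounds[OF s] by (simp add: ennreal_mult[symmetric] mult.commute)
  finally show ?case .
qed simp

lemma luria_delbrueck_pgf: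
  assumes s: "0 \<le> s" "s \<le> 1" and c: "0 \<le> c"
  shows "measure_pmf.expectation (luria_delbrueck c) (\<lambda>j. s ^ j) = exp (- (c * (1 - ld_jump_pgf s)))"
proof -
  let ?\<phi> = "ld_jump_pgf s"
  have \<phi>: "0 \<le> ?\<phi>" using ld_jump_pgf_bounds[OF s] by simp
  have "(\<integral>\<^sup>+k. ennreal (?\<phi> ^ k) \<partial>measure_pmf (poisson0_pmf c)) = ennreal (exp (- (c * (1 - ?\<phi>))))"
  proof (cases "c = 0")
    case True then show ?thesis by (simp add: poisson0_pmf_def)
  next
    case False
    then have c: "c > 0" using c by simp
    have "(\<integral>\<^sup>+k. ennreal (?\<phi> ^ k) \<partial>measure_pmf (poisson0_pmf c)) = (\<Sum>k. ennreal (c ^ k / fact k * exp (- c) * ?\<phi> ^ k))"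
      using c \<phi> by (simp add: poisson0_pmf_def nn_integral_measure_pmf nn_integral_count_space_nat ennreal_mult[symmetric])
    also have "\<dots> = ennreal (exp (- (c * (1 - ?\<phi>))))"
    proof (rule suminf_ennreal_eq)
      have "(\<lambda>k. exp (- c) * ((c * ?\<phi>) ^ k /\<^sub>R fact k)) sums (exp (- c) * exp (c * ?\<phi>))"
        by (intro sums_mult exp_converges)
      then show "(\<lambda>k. c ^ k / fact k * exp (- c) * ?\<phi> ^ k) sums exp (- (c * (1 - ?\<phi>)))"
        by (simp add: mult_exp_exp algebra_simps power_mult_distrib divide_inverse)
    qed (use c \<phi> in auto)
    finally show ?thesis .
  qed
  then have "ennreal (measure_pmf.expectation (luria_delbrueck c) (\<lambda>j. s ^ j)) = ennreal (exp (- (c * (1 - ?\<phi>))))"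
    unfolding nn_integral_pgf[OF s, symmetric] luria_delbrueck_def by (simp add: nn_integral_ld_sum[OF s])
  moreover have "0 \<le> measure_pmf.expectation (luria_delbrueck c) (\<lambda>j. s ^ j)"
    using s by (intro Bochner_Integration.integral_nonneg) auto
  ultimately show ?thesis by simp
qed

section \<open>Convergence of the mutation spectrum\<close>

lemma exp_minus_lipschitz:
  fixes a b :: real
  assumes "0 \<le> a" "0 \<le> b"
  shows "\<bar>exp (- a) - exp (- b)\<bar> \<le> \<bar>a - b\<bar>"
proof -
  have *: "exp (- x) - exp (- y) \<le> y - x" if "0 \<le> x" "x \<le> y" for x y :: real
  proof -
    have "exp (- x) - exp (- y) = exp (- x) * (1 - exp (- (y - x)))"
      by (simp add: algebra_simps mult_exp_exp)
    also have "\<dots> \<le> 1 * (y - x)"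
    proof (rule mult_mono)
      show "1 - exp (- (y - x)) \<le> y - x" using exp_ge_add_one_self[of "- (y - x)"] by linarith
    qed (use that in auto)
    finally show ?thesis by simp
  qed
  show ?thesis
    using *[of a b] *[of b a] assms by (cases "a \<le> b") (auto simp: abs_if)
qed

lemma exp_minus_approx:
  fixes y :: real
  assumes "0 \<le> y"
  shows "\<bar>1 - y - exp (- y)\<bar> \<le> y\<^sup>2"
proof -
  have "exp (- y) * (1 + y) \<le> exp (- y) * exp y"
    using exp_ge_add_one_self[of y] by (intro mult_left_mono) auto
  also have "\<dots> = 1" by (simp add: mult_exp_exp)
  also have "1 \<le> (1 - y + y\<^sup>2) * (1 + y)"
    using assms by (simp add: algebra_simps power2_eq_square)
  finally have "exp (- y) \<le> 1 - y + y\<^sup>2" using assms by simp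
  moreover have "1 - y \<le> exp (- y)" using exp_ge_add_one_self[of "- y"] by simp
  ultimately show ?thesis by (simp add: abs_le_iff)
qed

lemma sum_power_clone_size:
  fixes s :: real
  assumes s: "0 \<le> s" "s \<le> 1" and T: "finite T"
  shows "\<bar>(\<Sum>w\<in>tree_nodes T. s ^ clone_size T w) - (\<Sum>j<J. real (clone_count T j) * s ^ j)\<bar>
    \<le> real (card (tree_nodes T)) * s ^ J"
proof -
  note fin = finite_tree_nodes[OF T]
  let ?N = "tree_nodes T"
  let ?L = "{w \<in> ?N. clone_size T w < J}" and ?H = "{w \<in> ?N. \<not> clone_size T w < J}"
  have "(\<Sum>w\<in>?N. s ^ clone_size T w) = (\<Sum>w\<in>?L. s ^ clone_size T w) + (\<Sum>w\<in>?H. s ^ clone_size T w)"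
    using fin by (subst sum.union_disjoint[symmetric]) (auto intro!: sum.cong)
  also have "(\<Sum>w\<in>?L. s ^ clone_size T w) = (\<Sum>j<J. \<Sum>w\<in>{w \<in> ?L. clone_size T w = j}. s ^ clone_size T w)"
    using fin by (intro sum.group[symmetric]) auto
  also have "\<dots> = (\<Sum>j<J. real (clone_count T j) * s ^ j)"
  proof (rule sum.cong[OF refl])
    fix j assume "j \<in> {..<J}"
    then have "{w \<in> ?L. clone_size T w = j} = {w \<in> ?N. clone_size T w = j}" by auto
    then show "(\<Sum>w\<in>{w \<in> ?L. clone_size T w = j}. s ^ clone_size T w) = real (clone_count T j) * s ^ j"
      by (simp add: clone_count_def)
  qed
  finally have "(\<Sum>w\<in>?N. s ^ clone_size T w) - (\<Sum>j<J. real (clone_count T j) * s ^ j) = (\<Sum>w\<in>?H. s ^ clone_size T w)"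
    by simp
  moreover have "0 \<le> (\<Sum>w\<in>?H. s ^ clone_size T w)" using s by (intro sum_nonneg) auto
  moreover have "(\<Sum>w\<in>?H. s ^ clone_size T w) \<le> real (card ?N) * s ^ J"
  proof -
    have "(\<Sum>w\<in>?H. s ^ clone_size T w) \<le> (\<Sum>w\<in>?H. s ^ J)"
      using s by (intro sum_mono power_decreasing) auto
    also have "\<dots> = real (card ?H) * s ^ J" by simp
    also have "\<dots> \<le> real (card ?N) * s ^ J"
      using s fin by (intro mult_right_mono) (auto intro: card_mono)
    finally show ?thesis .
  qed
  ultimately show ?thesis by simp
qed

lemma clone_pgf_approx:
  fixes s mu \<theta> :: real
  assumes mu: "0 \<le> mu" "mu \<le> 1" and s: "0 \<le> s" "s \<le> 1" and \<theta>: "0 \<le> \<theta>"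
    and T: "T \<in> set_pmf (yule_tree m)"
  shows "\<bar>clone_pgf mu s T - exp (- (2 * \<theta> * (1 - ld_jump_pgf s)))\<bar>
    \<le> 2 * (real m * mu) * mu + 2 * \<bar>real m * mu - \<theta>\<bar> + 2 * \<bar>real (Suc m) * mu - \<theta>\<bar>
      + 4 * (real (Suc m) * mu) * s ^ J + mu * (\<Sum>j<J. \<bar>clone_deviation j T\<bar>)"
proof -
  have leaf: "leaf_set T" "card T = Suc m" using yule_tree_leaf_set[OF T] by auto
  have fin: "finite T" using leaf_setD(1)[OF leaf(1)] .
  have N: "card (tree_nodes T) = 2 * m" using card_tree_nodes[OF T] .
  define \<phi> where "\<phi> = ld_jump_pgf s"
  have \<phi>: "0 \<le> \<phi>" "\<phi> \<le> 1" using ld_jump_pgf_bounds[OF s] by (auto simp: \<phi>_def)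
  define y where "y w = mu * (1 - s ^ clone_size T w)" for w
  have pow: "0 \<le> s ^ k" "s ^ k \<le> 1" for k using s by (auto simp: power_le_one)
  have y: "0 \<le> y w" "y w \<le> mu" for w
    using mu pow[of "clone_size T w"] by (auto simp: y_def mult_left_le)
  define Y where "Y = (\<Sum>w\<in>tree_nodes T. y w)"
  have Y0: "0 \<le> Y" unfolding Y_def using y by (simp add: sum_nonneg)
  have "\<bar>clone_pgf mu s T - exp (- Y)\<bar> = \<bar>(\<Prod>w\<in>tree_nodes T. 1 - y w) - (\<Prod>w\<in>tree_nodes T. exp (- y w))\<bar>"
    by (simp add: clone_pgf_def Y_def y_def exp_sum[OF finite_tree_nodes[OF fin]] sum_negf[symmetric] algebra_simps)
  also have "\<dots> \<le> (\<Sum>w\<in>tree_nodes T. \<bar>(1 - y w) - exp (- y w)\<bar>)"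
  proof -
    have "norm (1 - y w) \<le> 1" "norm (exp (- y w)) \<le> 1" for w
      using y[of w] mu by auto
    then show ?thesis using norm_prod_diff[of "tree_nodes T" "\<lambda>w. 1 - y w" "\<lambda>w. exp (- y w)"] by simp
  qed
  also have "\<dots> \<le> (\<Sum>w\<in>tree_nodes T. mu * mu)"
  proof (rule sum_mono)
    fix w
    have "(y w)\<^sup>2 \<le> mu * mu" using y[of w] by (simp add: power2_eq_square mult_mono)
    then show "\<bar>(1 - y w) - exp (- y w)\<bar> \<le> mu * mu" using exp_minus_approx[OF y(1)[of w]] by linarith
  qed
  also have "\<dots> = 2 * (real m * mu) * mu" using N by simp
  finally have 1: "\<bar>clone_pgf mu s T - exp (- Y)\<bar> \<le> 2 * (real m * mu) * mu" .
  have scale: "\<bar>mu * a - mu * b\<bar> = mu * \<bar>a - b\<bar>" for a b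
    using mu by (simp add: abs_mult flip: right_diff_distrib)
  define D where "D = mu * (\<Sum>j<J. \<bar>clone_deviation j T\<bar>)"
  have 2: "\<bar>exp (- Y) - exp (- (2 * \<theta> * (1 - \<phi>)))\<bar> \<le> \<bar>Y - 2 * \<theta> * (1 - \<phi>)\<bar>"
    using Y0 \<theta> \<phi> by (intro exp_minus_lipschitz) auto
  define X where "X = (\<Sum>w\<in>tree_nodes T. s ^ clone_size T w)"
  define M where "M = (\<Sum>j<J. real (clone_count T j) * s ^ j)"
  define P where "P = (\<Sum>j<J. ld_weight j * s ^ j)"
  have YX: "Y = mu * (2 * real m) - mu * X"
    using N by (simp add: Y_def X_def y_def sum_subtractf right_diff_distrib flip: sum_distrib_left)
  have "\<bar>X - M\<bar> \<le> 2 * real m * s ^ J"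
    using sum_power_clone_size[OF s fin, of J] N by (simp add: X_def M_def)
  then have "\<bar>X - M\<bar> \<le> 2 * real (Suc m) * s ^ J"
    using pow[of J] by (simp add: algebra_simps)
  then have "mu * \<bar>X - M\<bar> \<le> mu * (2 * real (Suc m) * s ^ J)" using mu by (intro mult_left_mono)
  then have 3: "\<bar>mu * X - mu * M\<bar> \<le> 2 * (real (Suc m) * mu) * s ^ J"
    unfolding scale by (simp add: mult_ac del: of_nat_Suc)
  have "\<bar>M - 2 * real (Suc m) * P\<bar> = \<bar>\<Sum>j<J. clone_deviation j T * s ^ j\<bar>"
    by (simp add: M_def P_def clone_deviation_def leaf(2) sum_subtractf sum_distrib_left algebra_simps)
  also have "\<dots> \<le> (\<Sum>j<J. \<bar>clone_deviation j T\<bar>)"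
    by (rule sum_abs[THEN order_trans], rule sum_mono) (use pow in \<open>auto simp: abs_mult mult_left_le\<close>)
  finally have "mu * \<bar>M - 2 * real (Suc m) * P\<bar> \<le> D" unfolding D_def using mu by (intro mult_left_mono)
  then have 4: "\<bar>mu * M - 2 * (real (Suc m) * mu) * P\<bar> \<le> D"
    using scale[of M "2 * real (Suc m) * P"] by (simp add: mult_ac del: of_nat_Suc)
  have "\<bar>\<phi> - P\<bar> \<le> s ^ J"
    using pgf_tail[OF s, of ld_jump_pmf J] by (simp add: \<phi>_def ld_jump_pgf_def P_def pmf_ld_jump)
  then have "2 * (real (Suc m) * mu) * \<bar>\<phi> - P\<bar> \<le> 2 * (real (Suc m) * mu) * s ^ J"
    using mu by (intro mult_left_mono) auto
  moreover have "\<bar>2 * (real (Suc m) * mu) * P - 2 * (real (Suc m) * mu) * \<phi>\<bar> = 2 * (real (Suc m) * mu) * \<bar>\<phi> - P\<bar>"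
  proof -
    have "0 \<le> 2 * (real (Suc m) * mu)" using mu by simp
    then show ?thesis by (metis abs_minus_commute abs_mult abs_of_nonneg right_diff_distrib)
  qed
  ultimately have 5: "\<bar>2 * (real (Suc m) * mu) * P - 2 * (real (Suc m) * mu) * \<phi>\<bar> \<le> 2 * (real (Suc m) * mu) * s ^ J" by simp
  have "\<bar>2 * (real (Suc m) * mu) * \<phi> - 2 * \<theta> * \<phi>\<bar> = 2 * \<bar>real (Suc m) * mu - \<theta>\<bar> * \<phi>"
  proof -
    have "2 * (real (Suc m) * mu) * \<phi> - 2 * \<theta> * \<phi> = 2 * (real (Suc m) * mu - \<theta>) * \<phi>"
      by (simp only: left_diff_distrib right_diff_distrib)
    then show ?thesis using \<phi>(1) by (simp only: abs_mult abs_of_nonneg abs_numeral)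
  qed
  also have "\<dots> \<le> 2 * \<bar>real (Suc m) * mu - \<theta>\<bar>" using \<phi> by (intro mult_left_le) auto
  finally have 6: "\<bar>2 * (real (Suc m) * mu) * \<phi> - 2 * \<theta> * \<phi>\<bar> \<le> 2 * \<bar>real (Suc m) * mu - \<theta>\<bar>" .
  have 7: "\<bar>mu * (2 * real m) - 2 * \<theta>\<bar> = 2 * \<bar>real m * mu - \<theta>\<bar>"
    by (simp add: abs_if algebra_simps)
  have "Y - 2 * \<theta> * (1 - \<phi>) = (mu * (2 * real m) - 2 * \<theta>) - (mu * X - mu * M)
      - (mu * M - 2 * (real (Suc m) * mu) * P) - (2 * (real (Suc m) * mu) * P - 2 * (real (Suc m) * mu) * \<phi>)
      - (2 * (real (Suc m) * mu) * \<phi> - 2 * \<theta> * \<phi>)"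
    unfolding YX by (simp add: right_diff_distrib)
  then have "\<bar>Y - 2 * \<theta> * (1 - \<phi>)\<bar> \<le> 2 * \<bar>real m * mu - \<theta>\<bar> + 2 * \<bar>real (Suc m) * mu - \<theta>\<bar>
      + 4 * (real (Suc m) * mu) * s ^ J + D"
    using 3 4 5 6 7 by linarith
  then show ?thesis using 1 2 unfolding \<phi>_def D_def by linarith
qed

lemma expected_clone_pgf_approx:
  fixes s mu \<theta> :: real
  assumes mu: "0 \<le> mu" "mu \<le> 1" and s: "0 \<le> s" "s \<le> 1" and \<theta>: "0 \<le> \<theta>"
  shows "measure_pmf.expectation (yule_tree m) (\<lambda>T. \<bar>clone_pgf mu s T - exp (- (2 * \<theta> * (1 - ld_jump_pgf s)))\<bar>)
    \<le> 2 * (real m * mu) * mu + 2 * \<bar>real m * mu - \<theta>\<bar> + 2 * \<bar>real (Suc m) * mu - \<theta>\<bar>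
      + 4 * (real (Suc m) * mu) * s ^ J + (\<Sum>j<J. 1 + deviation_const j) * (mu * sqrt (real (Suc m)))"
proof -
  define c where "c = 2 * (real m * mu) * mu + 2 * \<bar>real m * mu - \<theta>\<bar> + 2 * \<bar>real (Suc m) * mu - \<theta>\<bar>
      + 4 * (real (Suc m) * mu) * s ^ J"
  have "measure_pmf.expectation (yule_tree m) (\<lambda>T. \<bar>clone_pgf mu s T - exp (- (2 * \<theta> * (1 - ld_jump_pgf s)))\<bar>)
    \<le> measure_pmf.expectation (yule_tree m) (\<lambda>T. c + mu * (\<Sum>j<J. \<bar>clone_deviation j T\<bar>))"
    using clone_pgf_approx[OF mu s \<theta>, of _ m J] unfolding c_def
    by (intro integral_mono_AE) (auto simp: integrable_yule_tree AE_measure_pmf_iff)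
  also have "\<dots> = c + mu * (\<Sum>j<J. measure_pmf.expectation (yule_tree m) (\<lambda>T. \<bar>clone_deviation j T\<bar>))"
    by (simp add: integrable_yule_tree)
  also have "\<dots> \<le> c + mu * (\<Sum>j<J. (1 + deviation_const j) * sqrt (real (Suc m)))"
    using mu clone_deviation_first_moment[of m] by (intro add_left_mono mult_left_mono sum_mono) auto
  also have "\<dots> = c + (\<Sum>j<J. 1 + deviation_const j) * (mu * sqrt (real (Suc m)))"
    by (simp add: sum_distrib_right[symmetric] mult_ac)
  finally show ?thesis by (simp add: c_def)
qed

lemma mutant_spectrum_cover:
  fixes mu \<delta> :: real and G :: "real \<Rightarrow> real"
  assumes mu: "0 \<le> mu" "mu \<le> 1" and S: "finite S" "S \<noteq> {}" and I: "finite I" "I \<subseteq> {0<..<1}" and \<delta>: "0 < \<delta>"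
  shows "\<exists>A\<in>sets (cell_space mu).
    {\<omega> \<in> space (cell_space mu). \<exists>s\<in>I. \<delta> \<le> \<bar>(\<Sum>i\<in>S. s ^ mutant_count u (Suc m) \<omega> i) / card S - G s\<bar>} \<subseteq> A \<and>
    measure (cell_space mu) A \<le> (\<Sum>s\<in>I. (mu\<^sup>2 * measure_pmf.expectation (yule_tree m) (\<lambda>T. real (card (nested_pairs T)))
      + 2 / sqrt (card S) + measure_pmf.expectation (yule_tree m) (\<lambda>T. \<bar>clone_pgf mu s T - G s\<bar>)) / \<delta>)"
proof -
  interpret P: prob_space lifetime_space by (rule prob_space_lifetime)
  interpret Q: prob_space "mutation_space mu" by (rule prob_space_mutation)
  interpret PQ: pair_prob_space lifetime_space "mutation_space mu" ..
  interpret C: prob_space "cell_space mu"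
    unfolding cell_space_def by (rule PQ.prob_space_axioms)
  define bad where "bad T s = {Z \<in> space (mutation_space mu). \<delta> \<le> \<bar>(\<Sum>i\<in>S. s ^ mutants u T Z i) / card S - G s\<bar>}" for T s
  let ?V = "set_pmf (yule_tree m)"
  let ?E = "\<lambda>T. {L. fst (jump_state m L) = T}"
  obtain N where N: "{L \<in> space lifetime_space. \<not> generic L} \<subseteq> N" "N \<in> sets lifetime_space" "emeasure lifetime_space N = 0"
    using AE_E[OF AE_generic] by blast
  define A where "A = N \<times> UNIV \<union> (\<Union>T\<in>?V. \<Union>s\<in>I. ?E T \<times> bad T s)"
  have fin: "finite T" if "T \<in> ?V" for T using yule_tree_leaf_set[OF that] leaf_setD(1) by blast
  have s01: "0 \<le> s" "s \<le> 1" if "s \<in> I" for s using I that by auto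
  have bad_sets: "bad T s \<in> sets (mutation_space mu)" if "T \<in> ?V" for T s
  proof -
    note [measurable] = measurable_mutants[OF fin[OF that]]
    show ?thesis unfolding bad_def by measurable
  qed
  have bad_le: "measure (mutation_space mu) (bad T s)
      \<le> (mu\<^sup>2 * real (card (nested_pairs T)) + 2 / sqrt (card S) + \<bar>clone_pgf mu s T - G s\<bar>) / \<delta>"
    if T: "T \<in> ?V" and s: "s \<in> I" for T s
  proof -
    have "measure (mutation_space mu) (bad T s)
        \<le> (\<integral>Z. \<bar>(\<Sum>i\<in>S. s ^ mutants u T Z i) / card S - G s\<bar> \<partial>mutation_space mu) / \<delta>"
      unfolding bad_def
      by (rule integral_Markov_inequality_measure[OF mutant_average_expectation(1)[OF mu s01[OF s] fin[OF T] S] sets.top])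
         (use \<delta> in auto)
    also have "\<dots> \<le> (mu\<^sup>2 * real (card (nested_pairs T)) + 2 / sqrt (card S) + \<bar>clone_pgf mu s T - G s\<bar>) / \<delta>"
      using mutant_average_expectation(2)[OF mu s01[OF s] fin[OF T] S, of u "G s"] \<delta>
      by (intro divide_right_mono) auto
    finally show ?thesis .
  qed
  have UNIV_sets: "UNIV \<in> sets (mutation_space mu)" using sets.top[of "mutation_space mu"] by simp
  have rect: "N \<times> UNIV \<in> sets (lifetime_space \<Otimes>\<^sub>M mutation_space mu)"
    "\<And>T s. T \<in> ?V \<Longrightarrow> ?E T \<times> bad T s \<in> sets (lifetime_space \<Otimes>\<^sub>M mutation_space mu)"
    using N(2) UNIV_sets emeasure_jump_state(1) bad_sets by auto
  have A: "A \<in> sets (cell_space mu)"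
    unfolding A_def cell_space_def using rect I finite_set_yule_tree
    by (intro sets.Un sets.finite_UN) auto
  have cover: "{\<omega> \<in> space (cell_space mu). \<exists>s\<in>I. \<delta> \<le> \<bar>(\<Sum>i\<in>S. s ^ mutant_count u (Suc m) \<omega> i) / card S - G s\<bar>} \<subseteq> A"
  proof
    fix \<omega> assume "\<omega> \<in> {\<omega> \<in> space (cell_space mu). \<exists>s\<in>I. \<delta> \<le> \<bar>(\<Sum>i\<in>S. s ^ mutant_count u (Suc m) \<omega> i) / card S - G s\<bar>}"
    then obtain s where s: "s \<in> I" "\<delta> \<le> \<bar>(\<Sum>i\<in>S. s ^ mutant_count u (Suc m) \<omega> i) / card S - G s\<bar>" by auto
    show "\<omega> \<in> A"
    proof (cases "generic (fst \<omega>)")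
      case False
      then have "fst \<omega> \<in> N" using N(1) by auto
      then show ?thesis unfolding A_def by (cases \<omega>) auto
    next
      case True
      define T where "T = fst (jump_state m (fst \<omega>))"
      have TV: "T \<in> ?V" using generic_jump_state[OF True, of m] by (simp add: T_def)
      have "mutant_count u (Suc m) \<omega> i = mutants u T (snd \<omega>) i" for i
        using alive_set_first_time[OF True, of m] by (simp add: mutant_count_def mutants_def T_def)
      then have "snd \<omega> \<in> bad T s" using s by (simp add: bad_def)
      then have "\<omega> \<in> ?E T \<times> bad T s" by (cases \<omega>) (simp add: T_def)
      then show ?thesis unfolding A_def using TV s(1) by blast
    qed
  qed
  have "measure (cell_space mu) A \<le> measure (cell_space mu) (N \<times> UNIV)
      + (\<Sum>T\<in>?V. \<Sum>s\<in>I. measure (cell_space mu) (?E T \<times> bad T s))"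
  proof -
    have "measure (cell_space mu) A \<le> measure (cell_space mu) (N \<times> UNIV)
       + measure (cell_space mu) (\<Union>T\<in>?V. \<Union>s\<in>I. ?E T \<times> bad T s)"
      unfolding A_def using rect[folded cell_space_def] I finite_set_yule_tree
      by (intro measure_Un_le sets.finite_UN) auto
    also have "measure (cell_space mu) (\<Union>T\<in>?V. \<Union>s\<in>I. ?E T \<times> bad T s)
      \<le> (\<Sum>T\<in>?V. measure (cell_space mu) (\<Union>s\<in>I. ?E T \<times> bad T s))"
      using rect[folded cell_space_def] I finite_set_yule_tree
      by (intro C.finite_measure_subadditive_finite image_subsetI sets.finite_UN) auto
    also have "\<dots> \<le> (\<Sum>T\<in>?V. \<Sum>s\<in>I. measure (cell_space mu) (?E T \<times> bad T s))"
      using rect[folded cell_space_def] I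
      by (intro sum_mono C.finite_measure_subadditive_finite) auto
    finally show ?thesis by simp
  qed
  also have "measure (cell_space mu) (N \<times> UNIV) = 0"
    unfolding cell_space_def using N UNIV_sets
    by (simp add: measure_def Q.emeasure_pair_measure_Times)
  also have "(\<Sum>T\<in>?V. \<Sum>s\<in>I. measure (cell_space mu) (?E T \<times> bad T s))
      = (\<Sum>T\<in>?V. \<Sum>s\<in>I. pmf (yule_tree m) T * measure (mutation_space mu) (bad T s))"
  proof (intro sum.cong refl)
    fix T s assume "T \<in> ?V"
    then have "emeasure (cell_space mu) (?E T \<times> bad T s)
      = ennreal (pmf (yule_tree m) T) * ennreal (measure (mutation_space mu) (bad T s))"
      unfolding cell_space_def using emeasure_jump_state bad_sets
      by (simp add: Q.emeasure_pair_measure_Times Q.emeasure_eq_measure)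
    then show "measure (cell_space mu) (?E T \<times> bad T s) = pmf (yule_tree m) T * measure (mutation_space mu) (bad T s)"
      by (simp add: measure_def enn2real_mult)
  qed
  also have "\<dots> \<le> (\<Sum>T\<in>?V. \<Sum>s\<in>I. pmf (yule_tree m) T * ((mu\<^sup>2 * real (card (nested_pairs T)) + 2 / sqrt (card S) + \<bar>clone_pgf mu s T - G s\<bar>) / \<delta>))"
    using bad_le by (intro sum_mono mult_left_mono) auto
  also have "\<dots> = (\<Sum>s\<in>I. \<Sum>T\<in>?V. pmf (yule_tree m) T * ((mu\<^sup>2 * real (card (nested_pairs T)) + 2 / sqrt (card S) + \<bar>clone_pgf mu s T - G s\<bar>) / \<delta>))"
    by (rule sum.swap)
  also have "\<dots> = (\<Sum>s\<in>I. measure_pmf.expectation (yule_tree m) (\<lambda>T. (mu\<^sup>2 * real (card (nested_pairs T)) + 2 / sqrt (card S) + \<bar>clone_pgf mu s T - G s\<bar>) / \<delta>))"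
    by (intro sum.cong refl, subst integral_measure_pmf[OF finite_set_yule_tree]) auto
  also have "\<dots> = (\<Sum>s\<in>I. (mu\<^sup>2 * measure_pmf.expectation (yule_tree m) (\<lambda>T. real (card (nested_pairs T)))
      + 2 / sqrt (card S) + measure_pmf.expectation (yule_tree m) (\<lambda>T. \<bar>clone_pgf mu s T - G s\<bar>)) / \<delta>)"
    by (simp add: integrable_yule_tree)
  finally show ?thesis using A cover by auto
qed

lemma pgf_close_imp_expectations_close:
  fixes p :: "nat pmf" and F :: "(nat \<Rightarrow> real) set"
  assumes "finite F" "\<forall>f\<in>F. bounded (range f)" and \<epsilon>: "\<epsilon> > 0"
  shows "\<exists>I \<delta>. finite I \<and> I \<subseteq> {0<..<1::real} \<and> 0 < \<delta> \<and>
    (\<forall>q. (\<forall>s\<in>I. \<bar>measure_pmf.expectation q (\<lambda>i. s ^ i) - measure_pmf.expectation p (\<lambda>i. s ^ i)\<bar> < \<delta>) \<longrightarrow>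
      (\<forall>f\<in>F. \<bar>measure_pmf.expectation q f - measure_pmf.expectation p f\<bar> < \<epsilon>))"
  using assms(1,2)
proof (induction F rule: finite_induct)
  case empty
  show ?case by (intro exI[of _ "{}"] exI[of _ 1]) auto
next
  case (insert f F)
  obtain I1 \<delta>1 where 1: "finite I1" "I1 \<subseteq> {0<..<1::real}" "0 < \<delta>1"
    "\<And>q. (\<forall>s\<in>I1. \<bar>measure_pmf.expectation q (\<lambda>i. s ^ i) - measure_pmf.expectation p (\<lambda>i. s ^ i)\<bar> < \<delta>1) \<Longrightarrow>
      (\<forall>f\<in>F. \<bar>measure_pmf.expectation q f - measure_pmf.expectation p f\<bar> < \<epsilon>)"
    using insert by auto
  obtain I2 \<delta>2 where 2: "finite I2" "I2 \<subseteq> {0<..<1::real}" "0 < \<delta>2"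
    "\<And>q. (\<forall>s\<in>I2. \<bar>measure_pmf.expectation q (\<lambda>i. s ^ i) - measure_pmf.expectation p (\<lambda>i. s ^ i)\<bar> < \<delta>2) \<Longrightarrow>
      \<bar>measure_pmf.expectation q f - measure_pmf.expectation p f\<bar> < \<epsilon>"
    using pgf_close_imp_expectation_close[of f \<epsilon> p] insert.prems \<epsilon> by auto
  show ?case
  proof (intro exI[of _ "I1 \<union> I2"] exI[of _ "min \<delta>1 \<delta>2"] conjI allI impI)
    fix q assume q: "\<forall>s\<in>I1 \<union> I2. \<bar>measure_pmf.expectation q (\<lambda>i. s ^ i) - measure_pmf.expectation p (\<lambda>i. s ^ i)\<bar> < min \<delta>1 \<delta>2"
    show "\<forall>f\<in>insert f F. \<bar>measure_pmf.expectation q f - measure_pmf.expectation p f\<bar> < \<epsilon>"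
      using 1(4)[of q] 2(4)[of q] q by simp
  qed (use 1 2 in auto)
qed

lemma expected_clone_pgf_tendsto:
  fixes m :: "nat \<Rightarrow> nat" and mu :: "nat \<Rightarrow> real" and \<theta> s :: real
  assumes mu: "\<And>k. 0 \<le> mu k \<and> mu k \<le> 1" and s: "0 < s" "s < 1" and \<theta>: "0 \<le> \<theta>"
    and mu0: "mu \<longlonglongrightarrow> 0" and mmu: "(\<lambda>k. real (m k) * mu k) \<longlonglongrightarrow> \<theta>"
    and Smmu: "(\<lambda>k. real (Suc (m k)) * mu k) \<longlonglongrightarrow> \<theta>"
    and rmu: "(\<lambda>k. mu k * sqrt (real (Suc (m k)))) \<longlonglongrightarrow> 0"
  shows "(\<lambda>k. measure_pmf.expectation (yule_tree (m k))
     (\<lambda>T. \<bar>clone_pgf (mu k) s T - exp (- (2 * \<theta> * (1 - ld_jump_pgf s)))\<bar>)) \<longlonglongrightarrow> 0"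
proof (rule order_tendstoI)
  fix a :: real assume "a < 0"
  moreover have "0 \<le> measure_pmf.expectation (yule_tree (m k))
     (\<lambda>T. \<bar>clone_pgf (mu k) s T - exp (- (2 * \<theta> * (1 - ld_jump_pgf s)))\<bar>)" for k
    by (intro Bochner_Integration.integral_nonneg) auto
  ultimately show "\<forall>\<^sub>F k in sequentially. a < measure_pmf.expectation (yule_tree (m k))
     (\<lambda>T. \<bar>clone_pgf (mu k) s T - exp (- (2 * \<theta> * (1 - ld_jump_pgf s)))\<bar>)"
    by (intro always_eventually allI) (rule less_le_trans)
next
  fix a :: real assume a: "0 < a"
  have "(\<lambda>J. 4 * \<theta> * s ^ J) \<longlonglongrightarrow> 4 * \<theta> * 0"
    using s by (intro tendsto_mult_left LIMSEQ_realpow_zero) auto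
  then have "\<forall>\<^sub>F J in sequentially. 4 * \<theta> * s ^ J < a" using a by (intro order_tendstoD) auto
  then obtain J where J: "4 * \<theta> * s ^ J < a" by (meson eventually_sequentially order_refl)
  define b where "b k = 2 * (real (m k) * mu k) * mu k + 2 * \<bar>real (m k) * mu k - \<theta>\<bar> + 2 * \<bar>real (Suc (m k)) * mu k - \<theta>\<bar>
      + 4 * (real (Suc (m k)) * mu k) * s ^ J + (\<Sum>j<J. 1 + deviation_const j) * (mu k * sqrt (real (Suc (m k))))" for k
  have "b \<longlonglongrightarrow> 2 * \<theta> * 0 + 2 * \<bar>\<theta> - \<theta>\<bar> + 2 * \<bar>\<theta> - \<theta>\<bar> + 4 * \<theta> * s ^ J + (\<Sum>j<J. 1 + deviation_const j) * 0"
    unfolding b_def by (intro tendsto_intros mu0 mmu Smmu rmu)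
  then have "b \<longlonglongrightarrow> 4 * \<theta> * s ^ J" by simp
  then have "\<forall>\<^sub>F k in sequentially. b k < a" using J by (rule order_tendstoD)
  then show "\<forall>\<^sub>F k in sequentially. measure_pmf.expectation (yule_tree (m k))
     (\<lambda>T. \<bar>clone_pgf (mu k) s T - exp (- (2 * \<theta> * (1 - ld_jump_pgf s)))\<bar>) < a"
  proof eventually_elim
    case (elim k)
    have "measure_pmf.expectation (yule_tree (m k))
     (\<lambda>T. \<bar>clone_pgf (mu k) s T - exp (- (2 * \<theta> * (1 - ld_jump_pgf s)))\<bar>) \<le> b k"
      unfolding b_def using mu[of k] s \<theta> by (intro expected_clone_pgf_approx) auto
    then show ?case using elim by simp
  qed
qed

theorem mainTheorem2:
  fixes n :: "nat \<Rightarrow> nat" and mu :: "nat \<Rightarrow> real" and S :: "nat \<Rightarrow> nat set"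
    and u :: "nat \<Rightarrow> nat \<Rightarrow> nucleotide" and \<theta> :: real
  assumes mu_range: "\<forall>k. 0 \<le> mu k \<and> mu k \<le> 1"
    and S_fin: "\<forall>k. finite (S k) \<and> S k \<noteq> {}"
    and n_lim: "filterlim n at_top sequentially"
    and mu_lim: "mu \<longlonglongrightarrow> 0"
    and nmu_lim: "(\<lambda>k. real (n k) * mu k) \<longlonglongrightarrow> \<theta>"
    and theta_nonneg: "\<theta> \<ge> 0"
    and S_lim: "filterlim (\<lambda>k. card (S k)) at_top sequentially"
  shows "\<forall>\<epsilon>>0. \<forall>F :: (nat \<Rightarrow> real) set. finite F \<and> (\<forall>f\<in>F. bounded (range f)) \<longrightarrow>
           (\<exists>A. (\<forall>k. A k \<in> sets (cell_space (mu k)) \<and>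
                   {\<omega> \<in> space (cell_space (mu k)). \<exists>f\<in>F.
                      \<bar>(\<Sum>i\<in>S k. f (mutant_count (u k) (n k) \<omega> i)) / real (card (S k))
                        - measure_pmf.expectation (luria_delbrueck (2 * \<theta>)) f\<bar> \<ge> \<epsilon>} \<subseteq> A k)
              \<and> (\<lambda>k. measure (cell_space (mu k)) (A k)) \<longlonglongrightarrow> 0)"
proof (intro allI impI, elim conjE)
  fix \<epsilon> :: real and F :: "(nat \<Rightarrow> real) set"
  assume \<epsilon>: "0 < \<epsilon>" and F: "finite F" "\<forall>f\<in>F. bounded (range f)"
  define \<Lambda> where "\<Lambda> = luria_delbrueck (2 * \<theta>)"
  define G where "G s = exp (- (2 * \<theta> * (1 - ld_jump_pgf s)))" for s
  obtain I \<delta> where I: "finite I" "I \<subseteq> {0<..<1::real}" and \<delta>: "0 < \<delta>"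
    and close: "\<And>q. (\<forall>s\<in>I. \<bar>measure_pmf.expectation q (\<lambda>i. s ^ i) - measure_pmf.expectation \<Lambda> (\<lambda>i. s ^ i)\<bar> < \<delta>) \<Longrightarrow>
      (\<forall>f\<in>F. \<bar>measure_pmf.expectation q f - measure_pmf.expectation \<Lambda> f\<bar> < \<epsilon>)"
    using pgf_close_imp_expectations_close[OF F \<epsilon>, of \<Lambda>] by auto
  have pgf: "measure_pmf.expectation \<Lambda> (\<lambda>i. s ^ i) = G s" if "s \<in> I" for s
    unfolding \<Lambda>_def G_def using that I theta_nonneg by (intro luria_delbrueck_pgf) auto
  define m where "m k = n k - 1" for k
  define b where "b k = (\<Sum>s\<in>I. ((mu k)\<^sup>2 * measure_pmf.expectation (yule_tree (m k)) (\<lambda>T. real (card (nested_pairs T)))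
      + 2 / sqrt (card (S k)) + measure_pmf.expectation (yule_tree (m k)) (\<lambda>T. \<bar>clone_pgf (mu k) s T - G s\<bar>)) / \<delta>)" for k
  let ?bad = "\<lambda>k. {\<omega> \<in> space (cell_space (mu k)). \<exists>f\<in>F.
      \<bar>(\<Sum>i\<in>S k. f (mutant_count (u k) (n k) \<omega> i)) / real (card (S k)) - measure_pmf.expectation \<Lambda> f\<bar> \<ge> \<epsilon>}"
  have bad: "?bad k \<subseteq> {\<omega> \<in> space (cell_space (mu k)).
      \<exists>s\<in>I. \<delta> \<le> \<bar>(\<Sum>i\<in>S k. s ^ mutant_count (u k) (n k) \<omega> i) / card (S k) - G s\<bar>}" for k
  proof (rule subsetI, rule ccontr)
    fix \<omega> assume \<omega>: "\<omega> \<in> ?bad k" "\<omega> \<notin> {\<omega> \<in> space (cell_space (mu k)).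
      \<exists>s\<in>I. \<delta> \<le> \<bar>(\<Sum>i\<in>S k. s ^ mutant_count (u k) (n k) \<omega> i) / card (S k) - G s\<bar>}"
    define q where "q = map_pmf (mutant_count (u k) (n k) \<omega>) (pmf_of_set (S k))"
    have q: "measure_pmf.expectation q f = (\<Sum>i\<in>S k. f (mutant_count (u k) (n k) \<omega> i)) / card (S k)" for f :: "nat \<Rightarrow> real"
      using S_fin by (simp add: q_def integral_pmf_of_set)
    have "\<forall>f\<in>F. \<bar>measure_pmf.expectation q f - measure_pmf.expectation \<Lambda> f\<bar> < \<epsilon>"
    proof (rule close, rule ballI)
      fix s assume s: "s \<in> I"
      then have "\<not> \<delta> \<le> \<bar>(\<Sum>i\<in>S k. s ^ mutant_count (u k) (n k) \<omega> i) / card (S k) - G s\<bar>"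
        using \<omega> by blast
      then show "\<bar>measure_pmf.expectation q (\<lambda>i. s ^ i) - measure_pmf.expectation \<Lambda> (\<lambda>i. s ^ i)\<bar> < \<delta>"
        by (simp only: q pgf[OF s] not_le)
    qed
    moreover obtain f where "f \<in> F"
      "\<epsilon> \<le> \<bar>(\<Sum>i\<in>S k. f (mutant_count (u k) (n k) \<omega> i)) / real (card (S k)) - measure_pmf.expectation \<Lambda> f\<bar>"
      using \<omega>(1) by blast
    ultimately show False by (simp only: q[symmetric]) (meson not_le)
  qed
  have "\<exists>A\<in>sets (cell_space (mu k)). ?bad k \<subseteq> A \<and> (n k \<noteq> 0 \<longrightarrow> measure (cell_space (mu k)) A \<le> b k)" for k
  proof (cases "n k = 0")
    case True
    then show ?thesis by (intro bexI[of _ "space (cell_space (mu k))"]) auto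
  next
    case False
    then have n: "n k = Suc (m k)" by (simp add: m_def)
    have "\<exists>A\<in>sets (cell_space (mu k)). {\<omega> \<in> space (cell_space (mu k)).
        \<exists>s\<in>I. \<delta> \<le> \<bar>(\<Sum>i\<in>S k. s ^ mutant_count (u k) (n k) \<omega> i) / card (S k) - G s\<bar>} \<subseteq> A \<and>
        measure (cell_space (mu k)) A \<le> b k"
      unfolding b_def n using mu_range S_fin I \<delta> by (intro mutant_spectrum_cover) auto
    then obtain A where A: "A \<in> sets (cell_space (mu k))" "{\<omega> \<in> space (cell_space (mu k)).
        \<exists>s\<in>I. \<delta> \<le> \<bar>(\<Sum>i\<in>S k. s ^ mutant_count (u k) (n k) \<omega> i) / card (S k) - G s\<bar>} \<subseteq> A"
        "measure (cell_space (mu k)) A \<le> b k" by blast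
    show ?thesis
      by (intro bexI[of _ A] conjI subset_trans[OF bad A(2)] impI A(1,3))
  qed
  then have "\<forall>k. \<exists>A. A \<in> sets (cell_space (mu k)) \<and> ?bad k \<subseteq> A \<and>
      (n k \<noteq> 0 \<longrightarrow> measure (cell_space (mu k)) A \<le> b k)"
    by blast
  then obtain A where "\<forall>k. A k \<in> sets (cell_space (mu k)) \<and> ?bad k \<subseteq> A k \<and>
      (n k \<noteq> 0 \<longrightarrow> measure (cell_space (mu k)) (A k) \<le> b k)"
    by (rule exE[OF choice])
  then have A: "\<And>k. A k \<in> sets (cell_space (mu k))" "\<And>k. ?bad k \<subseteq> A k"
    "\<And>k. n k \<noteq> 0 \<Longrightarrow> measure (cell_space (mu k)) (A k) \<le> b k"
    by simp_all
  have nz: "\<forall>\<^sub>F k in sequentially. n k \<noteq> 0"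
    using n_lim unfolding filterlim_at_top by (auto elim!: allE[of _ 1] eventually_mono)
  have ntop: "filterlim (\<lambda>k. sqrt (real (n k))) at_top sequentially"
    by (rule filterlim_compose[OF sqrt_at_top filterlim_compose[OF filterlim_real_sequentially n_lim]])
  have Stop: "filterlim (\<lambda>k. sqrt (real (card (S k)))) at_top sequentially"
    by (rule filterlim_compose[OF sqrt_at_top filterlim_compose[OF filterlim_real_sequentially S_lim]])
  have Sm: "\<forall>\<^sub>F k in sequentially. n k = Suc (m k)" using nz by eventually_elim (simp add: m_def)
  have Smmu: "(\<lambda>k. real (Suc (m k)) * mu k) \<longlonglongrightarrow> \<theta>"
    using nmu_lim by (rule Lim_transform_eventually) (use Sm in \<open>auto elim: eventually_mono\<close>)
  have "(\<lambda>k. real (Suc (m k)) * mu k - mu k) \<longlonglongrightarrow> \<theta> - 0" by (intro tendsto_diff Smmu mu_lim)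
  then have mmu: "(\<lambda>k. real (m k) * mu k) \<longlonglongrightarrow> \<theta>" by (simp add: algebra_simps)
  have "(\<lambda>k. (real (n k) * mu k) / sqrt (real (n k))) \<longlonglongrightarrow> 0"
    by (rule tendsto_divide_0[OF nmu_lim filterlim_at_top_imp_at_infinity[OF ntop]])
  then have rmu: "(\<lambda>k. mu k * sqrt (real (Suc (m k)))) \<longlonglongrightarrow> 0"
  proof (rule Lim_transform_eventually)
    show "\<forall>\<^sub>F k in sequentially. real (n k) * mu k / sqrt (real (n k)) = mu k * sqrt (real (Suc (m k)))"
      using Sm
    proof eventually_elim
      case (elim k)
      then have "real (n k) = sqrt (real (n k)) * sqrt (real (n k))" "sqrt (real (n k)) \<noteq> 0" by auto
      then show ?case unfolding elim[symmetric] by (simp add: field_simps)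
    qed
  qed
  have nested: "(\<lambda>k. (mu k)\<^sup>2 * measure_pmf.expectation (yule_tree (m k)) (\<lambda>T. real (card (nested_pairs T)))) \<longlonglongrightarrow> 0"
  proof (rule tendsto_sandwich[OF _ _ tendsto_const])
    have "(\<lambda>k. 8 * (real (m k) * mu k) * (mu k * sqrt (real (Suc (m k))))) \<longlonglongrightarrow> 8 * \<theta> * 0"
      by (intro tendsto_intros mmu rmu)
    then show "(\<lambda>k. 8 * (real (m k) * mu k) * (mu k * sqrt (real (Suc (m k))))) \<longlonglongrightarrow> 0" by simp
    show "\<forall>\<^sub>F k in sequentially. (mu k)\<^sup>2 * measure_pmf.expectation (yule_tree (m k)) (\<lambda>T. real (card (nested_pairs T)))
        \<le> 8 * (real (m k) * mu k) * (mu k * sqrt (real (Suc (m k))))"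
    proof (intro always_eventually allI)
      fix k
      have "(mu k)\<^sup>2 * measure_pmf.expectation (yule_tree (m k)) (\<lambda>T. real (card (nested_pairs T)))
        \<le> (mu k)\<^sup>2 * (8 * real (m k) * sqrt (real (Suc (m k))))"
        by (intro mult_left_mono expected_nested_pairs) simp
      then show "(mu k)\<^sup>2 * measure_pmf.expectation (yule_tree (m k)) (\<lambda>T. real (card (nested_pairs T)))
        \<le> 8 * (real (m k) * mu k) * (mu k * sqrt (real (Suc (m k))))"
        by (simp only: power2_eq_square mult_ac)
    qed
    show "\<forall>\<^sub>F k in sequentially. 0 \<le> (mu k)\<^sup>2 * measure_pmf.expectation (yule_tree (m k)) (\<lambda>T. real (card (nested_pairs T)))"
      by (intro always_eventually allI mult_nonneg_nonneg Bochner_Integration.integral_nonneg) auto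
  qed
  have "(\<lambda>k. 2 / sqrt (card (S k))) \<longlonglongrightarrow> 0"
    by (rule tendsto_divide_0[OF tendsto_const filterlim_at_top_imp_at_infinity[OF Stop]])
  moreover have "(\<lambda>k. measure_pmf.expectation (yule_tree (m k)) (\<lambda>T. \<bar>clone_pgf (mu k) s T - G s\<bar>)) \<longlonglongrightarrow> 0"
    if "s \<in> I" for s
    unfolding G_def using that I mu_range theta_nonneg
    by (intro expected_clone_pgf_tendsto mu_lim mmu Smmu rmu) auto
  ultimately have "b \<longlonglongrightarrow> (\<Sum>s\<in>I. (0 + 0 + 0) / \<delta>)"
    unfolding b_def using \<delta> by (intro tendsto_sum tendsto_divide tendsto_add nested tendsto_const) auto
  then have b0: "b \<longlonglongrightarrow> 0" by simp
  have "\<forall>\<^sub>F k in sequentially. measure (cell_space (mu k)) (A k) \<le> b k"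
    using nz by eventually_elim (rule A(3))
  then have "(\<lambda>k. measure (cell_space (mu k)) (A k)) \<longlonglongrightarrow> 0"
    by (intro tendsto_sandwich[OF _ _ tendsto_const b0]) simp_all
  then show "\<exists>A. (\<forall>k. A k \<in> sets (cell_space (mu k)) \<and>
                   {\<omega> \<in> space (cell_space (mu k)). \<exists>f\<in>F.
                      \<bar>(\<Sum>i\<in>S k. f (mutant_count (u k) (n k) \<omega> i)) / real (card (S k))
                        - measure_pmf.expectation (luria_delbrueck (2 * \<theta>)) f\<bar> \<ge> \<epsilon>} \<subseteq> A k)
              \<and> (\<lambda>k. measure (cell_space (mu k)) (A k)) \<longlonglongrightarrow> 0"
    using A(1,2) unfolding \<Lambda>_def by (intro exI[of _ A]) blast
qed

end
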